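(* Let $\lambda=\lambda_n\in\mathbb{R}^d_+$ be a smoothing parameter (possibly depending on $n$) and let $\mu$ be a measure on $\mathcal{X}\times\mathcal{Y}$. Suppose that $\{\ell_\lambda(g):g\in\mathcal{G}\}$ is an LB-class with respect to $\mu$ with parameters $(c(\lambda),K(\lambda))$ and that it has approximation function $a(\lambda)$ (with some residual constant $0<r<1$), where, for some $\kappa>1$, $0<\rho<1$ and $C_1>0$, $$a(\lambda)\le C_1\left(\frac{c(\lambda)}{\sqrt n}\right)^{\frac{2\kappa}{2\kappa+\rho-1}}\quad\text{and}\quad K(\lambda)\le\frac{c(\lambda)^{\frac{2\kappa}{2\kappa+\rho-1}}\,n^{\frac{\kappa+\rho-1}{2\kappa+\rho-1}}}{1+\log n}.$$ Suppose that $g^*\in\arg\min_{g\in\mathcal{G}}R_\ell(g)$ is unique and that $\{\ell(g)-\ell(g^* ):g\in\mathcal{G}\}$ is a Bernstein class with respect to $\mu$ with parameter $\kappa$ (and constant $\kappa_0$). Suppose that for every $\delta>0$, $$\tilde\omega_n(\mathcal{G},\delta,\mu):=\mathbb{E}\sup_{g,g'\in\mathcal{G}:\|\ell(g)-\ell(g')\|_{L_2(\mu)}\le\delta}\left|(\tilde P-\tilde P_n)(\ell_\lambda(g)-\ell_\lambda(g'))\right|\le C_2\frac{c(\lambda)}{\sqrt n}\,\delta^{1-\rho}$$ for some $C_2>0$. Then the estimator $\hat g_n^\lambda\in\arg\min_{g\in\mathcal{G}}\frac1n\sum_{i=1}^n\ell_\lambda(g,(Z_i,Y_i))$ satisfies,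 for $n$ large enough, $$\mathbb{E}R_\ell(\hat g_n^\lambda)-R_\ell(g^* )\le C\left(\frac{c(\lambda)}{\sqrt n}\right)^{\frac{2\kappa}{2\kappa+\rho-1}},$$ where $C=C(C_1,C_2,\kappa,\kappa_0,\rho)>0$.
   Context: Setting. $\mathcal{Y}=\{0,1,\dots,M\}$ with $M\ge1$; $\mathcal{X},\tilde{\mathcal{X}}\subseteq\mathbb{R}^d$; $\nu$ is a $\sigma$-finite measure. $(X,Y)\in\mathcal{X}\times\mathcal{Y}$ is a random couple with law $P$; $X$ has density $f$ with respect to $\nu$; $p_y=p(y)=\mathbb{P}(Y=y)$ and $f_y$ is the conditional density of $X$ given $Y=y$. $A:L_2(\nu,\mathcal{X})\to L_2(\nu,\tilde{\mathcal{X}})$ is a known linear compact operator. One observes an i.i.d. sample $(Z_1,Y_1),\dots,(Z_n,Y_n)$ with law $\tilde P$, where $Z\in\tilde{\mathcal{X}}$ has density $Af$ with respect to $\nu$ (and conditional density $Af_y$ given $Y=y$). $\tilde P_n=\frac1n\sum_{i=1}^n\delta_{(Z_i,Y_i)}$ is the empirical measure, and for a measure $Q$ and a function $h$, $Qh=\int h\,dQ$. $\mathcal{G}$ is a class of measurable functions $g:\mathcal{X}\to\mathbb{R}$, $\ell:\mathbb{R}\times\mathcal{Y}\to[0,1]$ is a loss function, and $\ell(g)$ denotes the function $(x,y)\mapsto\ell(g(x),y)$. The risk is $R_\ell(g)=\mathbb{E}_P\ell(g(X),Y)$. Given a function $k_\lambda:\tilde{\mathcal{X}}\times\mathcal{X}\to\mathbb{R}$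 depending on $\lambda\in\mathbb{R}_+^d$, $$\ell_\lambda(g,(z,y))=\int_{\mathcal{X}}\ell(g(x),y)k_\lambda(z,x)\,\nu(dx),$$ $\ell_\lambda(g)$ denotes $(z,y)\mapsto\ell_\lambda(g,(z,y))$, $R_n^\lambda(g)=\frac1n\sum_{i=1}^n\ell_\lambda(g,(Z_i,Y_i))$ and $R_\ell^\lambda(g)=\mathbb{E}R_n^\lambda(g)$. Minimizers are assumed to exist. LB-class: $\{\ell_\lambda(g):g\in\mathcal{G}\}$ is an LB-class with respect to $\mu$ with parameters $(c(\lambda),K(\lambda))$ if (Lipschitz) $\|\ell_\lambda(g)-\ell_\lambda(g')\|_{L_2(\tilde P)}\le c(\lambda)\|\ell(g)-\ell(g')\|_{L_2(\mu)}$ for all $g,g'\in\mathcal{G}$, and (bounded) $\sup_{g\in\mathcal{G}}\sup_{(z,y)}|\ell_\lambda(g,(z,y))|\le K(\lambda)$. Bernstein class: for $\kappa\ge1$, a class $\mathcal{F}$ of functions on $\mathcal{X}\times\mathcal{Y}$ is a Bernstein class with respect to $\mu$ with parameter $\kappa$ if there is $\kappa_0\ge0$ such that $\|f\|_{L_2(\mu)}^2\le\kappa_0[\mathbb{E}_Pf]^{1/\kappa}$ for every $f\in\mathcal{F}$. Approximation function: $\{\ell_\lambda(g):g\in\mathcal{G}\}$ has approximation function $a(\lambda)$ and residual constant $0<r<1$ if for all $g\in\mathcal{G}$, $$R_\ell(g)-R_\ell(g^* )-R_\ell^\lambda(g)+R_\ell^\lambda(g^* )\le a(\lambda)+r(R_\ell(g)-R_\ell(g^*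 )).$$
   Formalization: The constant C is allowed to depend also on the residual constant r, in addition to C_1, C_2, κ, κ_0 and ρ; no constant serving all r in (0,1) exists, since the excess risk can be of order C_1/(1-r) times the rate. *)

theory Defs
  imports "HOL-Probability.Probability"
begin

text \<open>
  Points of \<open>\<real>\<^sup>d\<close> are extensional functions on \<open>{..<d}\<close>, so that the dimension is a term and a
  constant can be chosen uniformly in it.
\<close>

abbreviation Rd :: "nat \<Rightarrow> (nat \<Rightarrow> real) measure" where
  "Rd d \<equiv> PiM {..<d} (\<lambda>_. borel)"

text \<open>The \<open>L\<^sub>2\<close> norm is extended-real valued: it is infinite, not \<open>0\<close>, off \<open>L\<^sub>2\<close>.\<close>

definition L2_norm :: "'a measure \<Rightarrow> ('a \<Rightarrow> real) \<Rightarrow> ennreal" where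
  "L2_norm N h =
     (let I = \<integral>\<^sup>+ x. ennreal ((h x)\<^sup>2) \<partial>N in if I = \<infinity> then \<infinity> else ennreal (sqrt (enn2real I)))"

definition L2_space :: "'a measure \<Rightarrow> ('a \<Rightarrow> real) set" where
  "L2_space N = {h \<in> borel_measurable N. L2_norm N h < \<infinity>}"

text \<open>
  Compact linear operators between \<open>L\<^sub>2\<close> spaces, acting on representatives; equalities are almost
  everywhere, and compactness is the sequential form (bounded sequences have images with an
  \<open>L\<^sub>2\<close>-convergent subsequence).
\<close>

definition compact_linear_operator ::
    "'a measure \<Rightarrow> 'b measure \<Rightarrow> (('a \<Rightarrow> real) \<Rightarrow> 'b \<Rightarrow> real) \<Rightarrow> bool" where
  "compact_linear_operator N N' A \<longleftrightarrow>
     (\<forall>h\<in>L2_space N. A h \<in> L2_space N') \<and>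
     (\<forall>h\<in>L2_space N. \<forall>h'\<in>L2_space N. (AE x in N. h x = h' x) \<longrightarrow> (AE z in N'. A h z = A h' z)) \<and>
     (\<forall>h\<in>L2_space N. \<forall>h'\<in>L2_space N. \<forall>a b.
        AE z in N'. A (\<lambda>x. a * h x + b * h' x) z = a * A h z + b * A h' z) \<and>
     (\<forall>h :: nat \<Rightarrow> 'a \<Rightarrow> real.
        (\<forall>i. h i \<in> L2_space N) \<and> (\<exists>B. \<forall>i. L2_norm N (h i) \<le> ennreal B) \<longrightarrow>
        (\<exists>\<phi> u. strict_mono (\<phi> :: nat \<Rightarrow> nat) \<and> u \<in> L2_space N' \<and>
           (\<lambda>i. L2_norm N' (\<lambda>z. A (h (\<phi> i)) z - u z)) \<longlonglongrightarrow> 0))"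

text \<open>
  \<open>P\<close> is the law of \<open>(X, Y)\<close> and \<open>Pt\<close> the law of the indirect observation \<open>(Z, Y)\<close>; the label
  probability \<open>p\<^sub>y\<close> is \<open>measure P (X \<times> {y})\<close>. The conditional density \<open>fy y\<close> enters through
  \<open>P (B \<times> {y}) = p\<^sub>y \<integral>\<^sub>B f\<^sub>y d\<nu>\<close>.
\<close>

locale inverse_learning =
  fixes d M :: nat
    and X Xt :: "(nat \<Rightarrow> real) set"
    and \<nu> :: "(nat \<Rightarrow> real) measure"
    and P Pt :: "((nat \<Rightarrow> real) \<times> nat) measure"
    and f :: "(nat \<Rightarrow> real) \<Rightarrow> real"
    and fy :: "nat \<Rightarrow> (nat \<Rightarrow> real) \<Rightarrow> real"
    and A :: "((nat \<Rightarrow> real) \<Rightarrow> real) \<Rightarrow> (nat \<Rightarrow> real) \<Rightarrow> real"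
  assumes M_ge_1: "1 \<le> M"
    and X_sets: "X \<in> sets (Rd d)"
    and Xt_sets: "Xt \<in> sets (Rd d)"
    and nu_sigma_finite: "sigma_finite_measure \<nu>"
    and nu_sets: "sets \<nu> = sets (Rd d)"
    and P_prob: "prob_space P"
    and P_sets: "sets P = sets (restrict_space (Rd d) X \<Otimes>\<^sub>M count_space {0..M})"
    and Pt_prob: "prob_space Pt"
    and Pt_sets: "sets Pt = sets (restrict_space (Rd d) Xt \<Otimes>\<^sub>M count_space {0..M})"
    and operator: "compact_linear_operator (restrict_space \<nu> X) (restrict_space \<nu> Xt) A"
    and f_L2: "f \<in> L2_space (restrict_space \<nu> X)"
    and f_nonneg: "AE x in restrict_space \<nu> X. 0 \<le> f x"
    and f_density: "distributed P (restrict_space \<nu> X) fst (\<lambda>x. ennreal (f x))"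
    and fy_L2: "\<And>y. y \<le> M \<Longrightarrow> fy y \<in> L2_space (restrict_space \<nu> X)"
    and fy_nonneg: "\<And>y. y \<le> M \<Longrightarrow> AE x in restrict_space \<nu> X. 0 \<le> fy y x"
    and fy_density: "\<And>y B. y \<le> M \<Longrightarrow> B \<in> sets (restrict_space \<nu> X) \<Longrightarrow>
      emeasure P (B \<times> {y}) =
        ennreal (measure P (X \<times> {y})) * (\<integral>\<^sup>+ x\<in>B. ennreal (fy y x) \<partial>restrict_space \<nu> X)"
    and Y_law: "\<And>y. y \<le> M \<Longrightarrow> measure Pt (Xt \<times> {y}) = measure P (X \<times> {y})"
    and Af_nonneg: "AE z in restrict_space \<nu> Xt. 0 \<le> A f z"
    and Af_density: "distributed Pt (restrict_space \<nu> Xt) fst (\<lambda>z. ennreal (A f z))"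
    and Afy_nonneg: "\<And>y. y \<le> M \<Longrightarrow> AE z in restrict_space \<nu> Xt. 0 \<le> A (fy y) z"
    and Afy_density: "\<And>y B. y \<le> M \<Longrightarrow> B \<in> sets (restrict_space \<nu> Xt) \<Longrightarrow>
      emeasure Pt (B \<times> {y}) =
        ennreal (measure P (X \<times> {y})) * (\<integral>\<^sup>+ z\<in>B. ennreal (A (fy y) z) \<partial>restrict_space \<nu> Xt)"

definition loss_function :: "nat \<Rightarrow> (real \<Rightarrow> nat \<Rightarrow> real) \<Rightarrow> bool" where
  "loss_function M loss \<longleftrightarrow>
     (\<forall>y\<le>M. (\<lambda>u. loss u y) \<in> borel_measurable borel \<and> (\<forall>u. 0 \<le> loss u y \<and> loss u y \<le> 1))"

definition loss_of :: "(real \<Rightarrow> nat \<Rightarrow> real) \<Rightarrow> ('x \<Rightarrow> real) \<Rightarrow> 'x \<times> nat \<Rightarrow> real" where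
  "loss_of loss g = (\<lambda>(x, y). loss (g x) y)"

definition risk :: "('x \<times> nat) measure \<Rightarrow> (real \<Rightarrow> nat \<Rightarrow> real) \<Rightarrow> ('x \<Rightarrow> real) \<Rightarrow> real" where
  "risk P loss g = (\<integral>w. loss_of loss g w \<partial>P)"

text \<open>
  In the following, \<open>N\<close> is \<open>\<nu>\<close> restricted to the input space and \<open>kl\<close> is the kernel
  \<open>k\<^sub>\<lambda>\<close> for a given smoothing parameter. Admissibility of the kernel says that \<open>l\<^sub>\<lambda>(g)\<close> is a
  well-defined measurable function, not the default value of a divergent integral.
\<close>

definition smooth_loss ::
    "'x measure \<Rightarrow> ('z \<Rightarrow> 'x \<Rightarrow> real) \<Rightarrow> (real \<Rightarrow> nat \<Rightarrow> real) \<Rightarrow> ('x \<Rightarrow> real) \<Rightarrow> 'z \<times> nat \<Rightarrow> real" where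
  "smooth_loss N kl loss g = (\<lambda>(z, y). \<integral>x. loss (g x) y * kl z x \<partial>N)"

definition admissible_kernel ::
    "'x measure \<Rightarrow> 'z measure \<Rightarrow> nat \<Rightarrow> (real \<Rightarrow> nat \<Rightarrow> real) \<Rightarrow> ('x \<Rightarrow> real) set \<Rightarrow>
      ('z \<Rightarrow> 'x \<Rightarrow> real) \<Rightarrow> bool" where
  "admissible_kernel N N' M loss G kl \<longleftrightarrow>
     (\<lambda>(z, x). kl z x) \<in> borel_measurable (N' \<Otimes>\<^sub>M N) \<and>
     (\<forall>g\<in>G. \<forall>z\<in>space N'. \<forall>y\<le>M. integrable N (\<lambda>x. loss (g x) y * kl z x))"

text \<open>A sample of size \<open>n\<close> is a function on \<open>{..<n}\<close>; its law is the \<open>n\<close>-fold product measure.\<close>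

definition sample_law :: "nat \<Rightarrow> 'a measure \<Rightarrow> (nat \<Rightarrow> 'a) measure" where
  "sample_law n Q = PiM {..<n} (\<lambda>_. Q)"

definition emp_mean :: "nat \<Rightarrow> (nat \<Rightarrow> 'a) \<Rightarrow> ('a \<Rightarrow> real) \<Rightarrow> real" where
  "emp_mean n s h = (\<Sum>i<n. h (s i)) / real n"

definition emp_smooth_risk ::
    "'x measure \<Rightarrow> ('z \<Rightarrow> 'x \<Rightarrow> real) \<Rightarrow> (real \<Rightarrow> nat \<Rightarrow> real) \<Rightarrow> nat \<Rightarrow> (nat \<Rightarrow> 'z \<times> nat) \<Rightarrow>
      ('x \<Rightarrow> real) \<Rightarrow> real" where
  "emp_smooth_risk N kl loss n s g = emp_mean n s (smooth_loss N kl loss g)"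

definition smooth_risk ::
    "'x measure \<Rightarrow> ('z \<Rightarrow> 'x \<Rightarrow> real) \<Rightarrow> (real \<Rightarrow> nat \<Rightarrow> real) \<Rightarrow> ('z \<times> nat) measure \<Rightarrow> nat \<Rightarrow>
      ('x \<Rightarrow> real) \<Rightarrow> real" where
  "smooth_risk N kl loss Pt n g = (\<integral>s. emp_smooth_risk N kl loss n s g \<partial>sample_law n Pt)"

definition LB_class ::
    "'x measure \<Rightarrow> ('z \<Rightarrow> 'x \<Rightarrow> real) \<Rightarrow> (real \<Rightarrow> nat \<Rightarrow> real) \<Rightarrow> ('z \<times> nat) measure \<Rightarrow>
      ('x \<times> nat) measure \<Rightarrow> ('x \<Rightarrow> real) set \<Rightarrow> real \<Rightarrow> real \<Rightarrow> bool" where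
  "LB_class N kl loss Pt \<mu> G c K \<longleftrightarrow>
     0 \<le> c \<and>
     (\<forall>g\<in>G. \<forall>g'\<in>G.
        L2_norm Pt (\<lambda>w. smooth_loss N kl loss g w - smooth_loss N kl loss g' w)
          \<le> ennreal c * L2_norm \<mu> (\<lambda>w. loss_of loss g w - loss_of loss g' w)) \<and>
     (\<forall>g\<in>G. \<forall>w\<in>space Pt. \<bar>smooth_loss N kl loss g w\<bar> \<le> K)"

definition bernstein_class ::
    "'a measure \<Rightarrow> 'a measure \<Rightarrow> real \<Rightarrow> real \<Rightarrow> ('a \<Rightarrow> real) set \<Rightarrow> bool" where
  "bernstein_class P \<mu> \<kappa> \<kappa>0 F \<longleftrightarrow>
     1 \<le> \<kappa> \<and> 0 \<le> \<kappa>0 \<and>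
     (\<forall>h\<in>F. (L2_norm \<mu> h)\<^sup>2 \<le> ennreal (\<kappa>0 * (\<integral>w. h w \<partial>P) powr (1 / \<kappa>)))"

definition approximation_function ::
    "'x measure \<Rightarrow> ('z \<Rightarrow> 'x \<Rightarrow> real) \<Rightarrow> (real \<Rightarrow> nat \<Rightarrow> real) \<Rightarrow> ('x \<times> nat) measure \<Rightarrow>
      ('z \<times> nat) measure \<Rightarrow> nat \<Rightarrow> ('x \<Rightarrow> real) set \<Rightarrow> ('x \<Rightarrow> real) \<Rightarrow> real \<Rightarrow> real \<Rightarrow> bool" where
  "approximation_function N kl loss P Pt n G gs a r \<longleftrightarrow>
     0 < r \<and> r < 1 \<and>
     (\<forall>g\<in>G. risk P loss g - risk P loss gs - smooth_risk N kl loss Pt n g + smooth_risk N kl loss Pt n gs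
        \<le> a + r * (risk P loss g - risk P loss gs))"

text \<open>
  Suprema over uncountable classes, and minimizers chosen among them, need not be measurable.
  Their expectations are outer expectations, which agree with the usual ones on measurable
  functions.
\<close>

definition outer_expectation :: "'a measure \<Rightarrow> ('a \<Rightarrow> ennreal) \<Rightarrow> ennreal" where
  "outer_expectation N F =
     (INF H\<in>{H \<in> borel_measurable N. \<forall>x\<in>space N. F x \<le> H x}. \<integral>\<^sup>+ x. H x \<partial>N)"

lemma outer_expectation_measurable:
  assumes "F \<in> borel_measurable N"
  shows "outer_expectation N F = (\<integral>\<^sup>+ x. F x \<partial>N)"
proof (rule antisym)
  show "outer_expectation N F \<le> (\<integral>\<^sup>+ x. F x \<partial>N)"
    unfolding outer_expectation_def using assms by (intro INF_lower) auto
  show "(\<integral>\<^sup>+ x. F x \<partial>N) \<le> outer_expectation N F"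
    unfolding outer_expectation_def by (intro INF_greatest nn_integral_mono) auto
qed

definition modulus ::
    "'x measure \<Rightarrow> ('z \<Rightarrow> 'x \<Rightarrow> real) \<Rightarrow> (real \<Rightarrow> nat \<Rightarrow> real) \<Rightarrow> ('z \<times> nat) measure \<Rightarrow> nat \<Rightarrow>
      ('x \<Rightarrow> real) set \<Rightarrow> real \<Rightarrow> ('x \<times> nat) measure \<Rightarrow> ennreal" where
  "modulus N kl loss Pt n G \<delta> \<mu> =
     outer_expectation (sample_law n Pt) (\<lambda>s.
       SUP (g, g')\<in>{(g, g'). g \<in> G \<and> g' \<in> G \<and>
                      L2_norm \<mu> (\<lambda>w. loss_of loss g w - loss_of loss g' w) \<le> ennreal \<delta>}.
         let h = (\<lambda>w. smooth_loss N kl loss g w - smooth_loss N kl loss g' w)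
         in ennreal \<bar>(\<integral>w. h w \<partial>Pt) - emp_mean n s h\<bar>)"

end

theory Submission
  imports Defs
begin

text \<open>
  By the choice of the estimator and of the approximation function, \<open>(1 - r) E \<le> a + \<Delta>\<close>, where
  \<open>E\<close> is the excess risk of the estimator and \<open>\<Delta>\<close> its empirical process increment. Let
  \<open>\<epsilon>\<close> be the claimed rate. By the Bernstein condition, on \<open>{E \<le> 2\<^sup>j \<epsilon>}\<close> the increment is at most
  a supremum whose mean is of order \<open>y\<^sup>j \<epsilon>\<close> with \<open>y = 2 powr ((1 - \<rho>) / (2 \<kappa>))\<close>.

  Talagrand's inequality can be avoided: second moments suffice. For centred independent summands
  bounded by \<open>b\<close>, the second moment of the supremum is at most a constant times \<open>(mean + b)\<^sup>2\<close>, and here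
  \<open>b\<close>, of order \<open>K(\<lambda>) / n\<close>, is at most of order \<open>\<epsilon>\<close>. Peeling over \<open>j\<close> bounds the expected excess risk
  by a multiple of \<open>\<epsilon> + \<Sum>\<^sub>j (y\<^sup>j \<epsilon>)\<^sup>2 / (2\<^sup>j \<epsilon>)\<close>, a geometric series with ratio \<open>y\<^sup>2 / 2 < 1\<close> because
  \<open>1 - \<rho> < \<kappa>\<close>.
\<close>

section \<open>Resampling a block of coordinates of an i.i.d. sample\<close>

text \<open>Integrating over \<open>z\<close> gives the conditional expectation given the
  coordinates in \<open>I\<close>. The restriction to \<open>{..<n}\<close> keeps the spliced sample
  extensional, hence a point of the product space.\<close>

definition resample :: "nat \<Rightarrow> nat set \<Rightarrow> (nat \<Rightarrow> 'a) \<Rightarrow> (nat \<Rightarrow> 'a) \<Rightarrow> nat \<Rightarrow> 'a" where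
  "resample n I s z = (\<lambda>i\<in>{..<n}. if i \<in> I then s i else z i)"

lemma space_sample_law: "space (sample_law n Q) = {..<n} \<rightarrow>\<^sub>E space Q"
  by (simp add: sample_law_def space_PiM)

lemma measurable_sample_component:
  "i < n \<Longrightarrow> (\<lambda>s. s i) \<in> measurable (sample_law n Q) Q"
  unfolding sample_law_def by (rule measurable_component_singleton) simp

lemma measurable_resample [measurable (raw)]:
  assumes f: "f \<in> measurable N (sample_law n Q)" and g: "g \<in> measurable N (sample_law n Q)"
  shows "(\<lambda>x. resample n I (f x) (g x)) \<in> measurable N (sample_law n Q)"
  unfolding resample_def
proof (subst sample_law_def, rule measurable_restrict)
  fix i assume "i \<in> {..<n}"
  then have "i < n" by simp
  note measurable_sample_component[OF this]
  from measurable_compose[OF f this] measurable_compose[OF g this]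
  show "(\<lambda>x. if i \<in> I then f x i else g x i) \<in> measurable N Q"
    by (cases "i \<in> I") (simp_all only: if_True if_False)
qed

lemma resample_apply: "i < n \<Longrightarrow> resample n I s z i = (if i \<in> I then s i else z i)"
  by (simp add: resample_def)

lemma resample_in_space:
  "s \<in> space (sample_law n Q) \<Longrightarrow> z \<in> space (sample_law n Q) \<Longrightarrow>
    resample n I s z \<in> space (sample_law n Q)"
  by (auto simp: resample_def space_sample_law PiE_iff)

context prob_space
begin

lemma prob_space_sample_law: "prob_space (sample_law n M)"
  unfolding sample_law_def by (rule prob_space_PiM) (rule prob_space_axioms)

lemma distr_sample_component: "i < n \<Longrightarrow> distr (sample_law n M) M (\<lambda>s. s i) = M"
  unfolding sample_law_def by (rule distr_PiM_component) (auto intro: prob_space_axioms)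

text \<open>A box pulls back to a product of two boxes, one per sample, whose probabilities multiply
  to that of the box; boxes determine the product measure.\<close>

lemma distr_resample:
  "distr (sample_law n M \<Otimes>\<^sub>M sample_law n M) (sample_law n M) (\<lambda>(s, z). resample n I s z)
    = sample_law n M" (is "?D = _")
proof -
  note space_1 = emeasure_space_1
  interpret S: prob_space "sample_law n M" by (rule prob_space_sample_law)
  interpret finite_product_prob_space "\<lambda>_. M" "{..<n}"
    by unfold_locales auto
  have box: "emeasure (sample_law n M) (Pi\<^sub>E {..<n} D) = (\<Prod>i<n. emeasure M (D i))"
    if "\<And>i. i < n \<Longrightarrow> D i \<in> sets M" for D
    unfolding sample_law_def by (rule emeasure_PiM) (auto simp: that)
  have meas: "(\<lambda>(s, z). resample n I s z)
      \<in> measurable (sample_law n M \<Otimes>\<^sub>M sample_law n M) (sample_law n M)"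
    by measurable
  have "?D = PiM {..<n} (\<lambda>_. M)"
  proof (rule PiM_eqI)
    fix A assume A: "\<And>i. i \<in> {..<n} \<Longrightarrow> A i \<in> sets M"
    \<comment> \<open>The constraint on coordinate \<open>i\<close> goes to the sample that supplies
      it; the other sample gets the whole space there, a factor one.\<close>
    define B C where "B i = (if i \<in> I then A i else space M)"
      and "C i = (if i \<in> I then space M else A i)" for i
    have BC: "B i \<in> sets M" "C i \<in> sets M" if "i < n" for i
      using A that by (auto simp: B_def C_def)
    have "(\<lambda>(s, z). resample n I s z) -` (Pi\<^sub>E {..<n} A) \<inter>
        space (sample_law n M \<Otimes>\<^sub>M sample_law n M) = (Pi\<^sub>E {..<n} B) \<times> (Pi\<^sub>E {..<n} C)"
    proof (rule set_eqI, rule iffI)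
      fix p assume p: "p \<in> (\<lambda>(s, z). resample n I s z) -` (Pi\<^sub>E {..<n} A) \<inter>
        space (sample_law n M \<Otimes>\<^sub>M sample_law n M)"
      obtain s z where p_eq: "p = (s, z)" by (cases p)
      from p have sz: "s \<in> {..<n} \<rightarrow>\<^sub>E space M" "z \<in> {..<n} \<rightarrow>\<^sub>E space M"
        by (auto simp: p_eq space_pair_measure space_sample_law)
      have r: "(if i \<in> I then s i else z i) \<in> A i" if "i < n" for i
        using p that by (auto simp: p_eq resample_def PiE_iff)
      have "s i \<in> B i" "z i \<in> C i" if "i < n" for i
        using r[OF that] sz that by (auto simp: B_def C_def PiE_iff split: if_splits)
      then show "p \<in> (Pi\<^sub>E {..<n} B) \<times> (Pi\<^sub>E {..<n} C)"
        using sz by (auto simp: p_eq PiE_iff)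
    next
      fix p assume p: "p \<in> (Pi\<^sub>E {..<n} B) \<times> (Pi\<^sub>E {..<n} C)"
      obtain s z where p_eq: "p = (s, z)" by (cases p)
      have "s i \<in> B i" "z i \<in> C i" if "i < n" for i
        using p that by (auto simp: p_eq PiE_iff)
      note sz = this
      have sub: "B i \<subseteq> space M" "C i \<subseteq> space M" if "i < n" for i
        using BC[OF that] by (auto dest: sets.sets_into_space)
      have "s i \<in> space M" "z i \<in> space M" "(if i \<in> I then s i else z i) \<in> A i"
        if "i < n" for i
        using sz[OF that] sub[OF that] by (auto simp: B_def C_def)
      moreover have "s \<in> extensional {..<n}" "z \<in> extensional {..<n}"
        using p by (auto simp: p_eq PiE_iff)
      ultimately show "p \<in> (\<lambda>(s, z). resample n I s z) -` (Pi\<^sub>E {..<n} A) \<inter>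
        space (sample_law n M \<Otimes>\<^sub>M sample_law n M)"
        by (simp add: p_eq space_pair_measure space_sample_law resample_def PiE_iff)
    qed
    then have "emeasure ?D (Pi\<^sub>E {..<n} A)
        = emeasure (sample_law n M \<Otimes>\<^sub>M sample_law n M) ((Pi\<^sub>E {..<n} B) \<times> (Pi\<^sub>E {..<n} C))"
      using A by (subst emeasure_distr[OF meas]) (auto simp: sample_law_def intro!: sets_PiM_I_finite)
    also have "\<dots> = emeasure (sample_law n M) (Pi\<^sub>E {..<n} B) * emeasure (sample_law n M) (Pi\<^sub>E {..<n} C)"
      using BC by (intro S.emeasure_pair_measure_Times) (auto simp: sample_law_def intro!: sets_PiM_I_finite)
    also have "\<dots> = (\<Prod>i<n. emeasure M (B i)) * (\<Prod>i<n. emeasure M (C i))"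
      using BC by (simp add: box)
    also have "\<dots> = (\<Prod>i<n. emeasure M (A i))"
      unfolding prod.distrib[symmetric]
      by (intro prod.cong) (auto simp: B_def C_def space_1)
    finally show "emeasure ?D (Pi\<^sub>E {..<n} A) = (\<Prod>i\<in>{..<n}. emeasure M (A i))" .
  qed (auto simp: sample_law_def)
  then show ?thesis by (simp add: sample_law_def)
qed

text \<open>This is the tower property of conditional expectation.\<close>

lemma nn_integral_resample:
  assumes [measurable]: "F \<in> borel_measurable (sample_law n M)"
  shows "(\<integral>\<^sup>+ s. \<integral>\<^sup>+ z. F (resample n I s z) \<partial>sample_law n M \<partial>sample_law n M)
    = (\<integral>\<^sup>+ s. F s \<partial>sample_law n M)"
proof -
  interpret S: prob_space "sample_law n M" by (rule prob_space_sample_law)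
  have "(\<integral>\<^sup>+ s. F s \<partial>sample_law n M)
      = (\<integral>\<^sup>+ p. F (case p of (s, z) \<Rightarrow> resample n I s z) \<partial>(sample_law n M \<Otimes>\<^sub>M sample_law n M))"
    by (subst distr_resample[of n I, symmetric], subst nn_integral_distr)
       (auto simp: case_prod_beta')
  then show ?thesis
    by (subst (asm) S.nn_integral_fst[symmetric]) auto
qed

text \<open>Independence of disjoint blocks of coordinates. Dependence on a block is expressed by
  invariance instead of sigma-algebras; after splicing, \<open>F\<close> sees only \<open>s\<close>
  and \<open>K\<close> only \<open>z\<close>, so the integral factors.\<close>

lemma nn_integral_mult_indep:
  fixes F K :: "(nat \<Rightarrow> 'a) \<Rightarrow> ennreal"
  assumes [measurable]: "F \<in> borel_measurable (sample_law n M)" "K \<in> borel_measurable (sample_law n M)"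
    and F: "\<And>s s'. s \<in> space (sample_law n M) \<Longrightarrow> s' \<in> space (sample_law n M) \<Longrightarrow>
      (\<And>i. i < n \<Longrightarrow> i \<in> I \<Longrightarrow> s i = s' i) \<Longrightarrow> F s = F s'"
    and K: "\<And>s s'. s \<in> space (sample_law n M) \<Longrightarrow> s' \<in> space (sample_law n M) \<Longrightarrow>
      (\<And>i. i < n \<Longrightarrow> i \<notin> I \<Longrightarrow> s i = s' i) \<Longrightarrow> K s = K s'"
  shows "(\<integral>\<^sup>+ s. F s * K s \<partial>sample_law n M)
    = (\<integral>\<^sup>+ s. F s \<partial>sample_law n M) * (\<integral>\<^sup>+ s. K s \<partial>sample_law n M)"
proof -
  have FK: "F (resample n I s z) = F s" "K (resample n I s z) = K z"
    if "s \<in> space (sample_law n M)" "z \<in> space (sample_law n M)" for s z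
    using that by (auto intro!: F K resample_in_space simp: resample_apply)
  have "(\<integral>\<^sup>+ s. F s * K s \<partial>sample_law n M)
      = (\<integral>\<^sup>+ s. \<integral>\<^sup>+ z. F s * K z \<partial>sample_law n M \<partial>sample_law n M)"
    by (subst nn_integral_resample[of _ n I, symmetric])
       (auto intro!: nn_integral_cong simp: FK)
  then show ?thesis
    by (simp add: nn_integral_cmult nn_integral_multc)
qed

section \<open>A second moment bound by stopping\<close>

text \<open>
  Averaging out the centred terms outside \<open>I\<close> is Jensen's inequality, with the measurable majorant
  \<open>H\<close> in the role of the norm of the full sum.
\<close>

lemma abs_partial_sum_le_resampled:
  assumes \<xi> [measurable]: "\<xi> \<in> borel_measurable M"
    and b: "\<And>w. w \<in> space M \<Longrightarrow> \<bar>\<xi> w\<bar> \<le> b"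
    and centred: "(\<integral>w. \<xi> w \<partial>M) = 0"
    and H: "\<And>s. s \<in> space (sample_law n M) \<Longrightarrow> ennreal \<bar>\<Sum>i<n. \<xi> (s i)\<bar> \<le> H s"
    and I: "I \<subseteq> {..<n}" and s: "s \<in> space (sample_law n M)"
  shows "ennreal \<bar>\<Sum>i\<in>I. \<xi> (s i)\<bar> \<le> (\<integral>\<^sup>+ z. H (resample n I s z) \<partial>sample_law n M)"
proof -
  interpret S: prob_space "sample_law n M" by (rule prob_space_sample_law)
  have int: "integrable (sample_law n M) (\<lambda>z. \<xi> (z i))" if "i < n" for i
  proof (rule S.integrable_const_bound[where B = b])
    show "AE z in sample_law n M. norm (\<xi> (z i)) \<le> b"
      using that b by (intro AE_I2) (auto simp: space_sample_law PiE_iff)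
    show "(\<lambda>z. \<xi> (z i)) \<in> borel_measurable (sample_law n M)"
      by (rule measurable_compose[OF measurable_sample_component[OF that] \<xi>])
  qed
  have int': "integrable (sample_law n M) (\<lambda>z. if i \<in> I then \<xi> (s i) else \<xi> (z i))"
    if "i < n" for i
    using int[OF that] by (cases "i \<in> I") auto
  have zero: "(\<integral>z. \<xi> (z i) \<partial>sample_law n M) = 0" if "i < n" for i
    using integral_distr[OF measurable_sample_component[OF that, of M] \<xi>]
    by (simp add: distr_sample_component[OF that] centred)
  \<comment> \<open>Coordinates in \<open>I\<close> are frozen at \<open>s\<close>; the others are
    random with mean zero, so the expectation of \<open>?f\<close> is the partial sum over
    \<open>I\<close>.\<close>
  let ?f = "\<lambda>z. \<Sum>i<n. (if i \<in> I then \<xi> (s i) else \<xi> (z i))"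
  have f: "?f z = (\<Sum>i<n. \<xi> (resample n I s z i))" for z
    by (intro sum.cong) (auto simp: resample_def)
  have "(\<integral>z. ?f z \<partial>sample_law n M) = (\<Sum>i<n. if i \<in> I then \<xi> (s i) else 0)"
    using zero by (subst Bochner_Integration.integral_sum)
      (auto intro!: sum.cong int' simp: S.prob_space)
  also have "\<dots> = (\<Sum>i\<in>I. \<xi> (s i))"
    using I by (simp add: sum.If_cases Int_absorb1)
  finally have "ennreal \<bar>\<Sum>i\<in>I. \<xi> (s i)\<bar> = ennreal (norm (\<integral>z. ?f z \<partial>sample_law n M))"
    by simp
  also have "\<dots> \<le> (\<integral>\<^sup>+ z. ennreal (norm (?f z)) \<partial>sample_law n M)"
    by (rule integral_norm_bound_ennreal, intro Bochner_Integration.integrable_sum int') auto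
  also have "\<dots> \<le> (\<integral>\<^sup>+ z. H (resample n I s z) \<partial>sample_law n M)"
    unfolding f real_norm_def using s by (intro nn_integral_mono H resample_in_space)
  finally show ?thesis .
qed

text \<open>
  A Hoffmann--Jorgensen type inequality. No supremum over the class is measured: the sum is stopped
  at the first time that the resampled majorant \<open>U\<close> of the terms since the previous stop exceeds
  \<open>t = 4 m\<close>. By Doob's argument this happens with probability at most \<open>1/4\<close>, and each stop costs at
  most \<open>t + b\<close>.
\<close>

lemma second_moment_majorant:
  fixes m b :: real and \<Xi> :: "('a \<Rightarrow> real) set" and H :: "(nat \<Rightarrow> 'a) \<Rightarrow> ennreal"
  assumes meas: "\<And>\<xi>. \<xi> \<in> \<Xi> \<Longrightarrow> \<xi> \<in> borel_measurable M"
    and bound: "\<And>\<xi> w. \<xi> \<in> \<Xi> \<Longrightarrow> w \<in> space M \<Longrightarrow> \<bar>\<xi> w\<bar> \<le> b"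
    and centred: "\<And>\<xi>. \<xi> \<in> \<Xi> \<Longrightarrow> (\<integral>w. \<xi> w \<partial>M) = 0"
    and H [measurable]: "H \<in> borel_measurable (sample_law n M)"
    and H_ge: "\<And>\<xi> s. \<xi> \<in> \<Xi> \<Longrightarrow> s \<in> space (sample_law n M) \<Longrightarrow> ennreal \<bar>\<Sum>i<n. \<xi> (s i)\<bar> \<le> H s"
    and H_le: "(\<integral>\<^sup>+ s. H s \<partial>sample_law n M) \<le> ennreal m"
    and m: "0 < m" and b: "0 \<le> b"
  obtains W where "W \<in> borel_measurable (sample_law n M)" "\<And>s. 0 \<le> W s"
    "\<And>s \<xi>. s \<in> space (sample_law n M) \<Longrightarrow> \<xi> \<in> \<Xi> \<Longrightarrow> \<bar>\<Sum>i<n. \<xi> (s i)\<bar> \<le> W s"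
    "(\<integral>\<^sup>+ s. ennreal ((W s)\<^sup>2) \<partial>sample_law n M) \<le> ennreal (3 * (4 * m + b)\<^sup>2)"
proof -
  define S where "S = sample_law n M"
  define t where "t = 4 * m"
  have t: "0 < t" using m by (simp add: t_def)
  interpret S: prob_space S unfolding S_def by (rule prob_space_sample_law)
  have H' [measurable]: "H \<in> borel_measurable S" by (simp add: S_def)
  have resample_S [measurable]: "(\<lambda>x. resample n I (f x) (g x)) \<in> measurable N S"
    if "f \<in> measurable N S" "g \<in> measurable N S" for I f g and N :: "'z measure"
    using that unfolding S_def by measurable
  \<comment> \<open>\<open>U j k\<close> is the conditional expectation of \<open>H\<close> given
    the coordinates from \<open>j\<close> up to but excluding \<open>k\<close>. It is measurable and
    dominates the absolute sums over this block for all \<open>\<xi>\<close> at once.\<close>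
  define U where "U j k s = (\<integral>\<^sup>+ z. H (resample n {j..<k} s z) \<partial>S)" for j k s
  have U_meas [measurable]: "U j k \<in> borel_measurable S" for j k
    unfolding U_def by measurable
  have U_cong: "U j k s = U j k s'" if "\<And>i. j \<le> i \<Longrightarrow> i < k \<Longrightarrow> s i = s' i" for j k s s'
  proof -
    have "resample n {j..<k} s z = resample n {j..<k} s' z" for z
      using that by (auto simp: resample_def fun_eq_iff)
    then show ?thesis by (simp add: U_def)
  qed
  have U_ge: "ennreal \<bar>\<Sum>i\<in>{j..<k}. \<xi> (s i)\<bar> \<le> U j k s"
    if "\<xi> \<in> \<Xi>" "k \<le> n" "s \<in> space S" for \<xi> j k s
    unfolding U_def S_def using that
    by (intro abs_partial_sum_le_resampled[where b = b] meas bound centred H_ge) (auto simp: S_def)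
  \<comment> \<open>The event that \<open>k\<close> is the first index after \<open>j\<close> at
    which \<open>U j k\<close> exceeds \<open>t\<close>. It is decided by the coordinates from
    \<open>j\<close> up to but excluding \<open>k\<close>, and different \<open>k\<close> give
    disjoint events.\<close>
  define A where "A j k = {s \<in> space S. ennreal t < U j k s \<and> (\<forall>l\<in>{j<..<k}. U j l s \<le> ennreal t)}"
    for j k
  have A_sets [measurable]: "A j k \<in> sets S" for j k
    unfolding A_def by measurable
  have A_cong: "s \<in> A j k \<longleftrightarrow> s' \<in> A j k"
    if "s \<in> space S" "s' \<in> space S" "\<And>i. j \<le> i \<Longrightarrow> i < k \<Longrightarrow> s i = s' i" for j k s s'
  proof -
    have "U j l s = U j l s'" if "l \<le> k" for l
      using that \<open>\<And>i. j \<le> i \<Longrightarrow> i < k \<Longrightarrow> s i = s' i\<close> by (intro U_cong) auto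
    then show ?thesis
      using that(1,2) by (auto simp: A_def)
  qed
  have A_unique: "k = k'" if "s \<in> A j k" "s \<in> A j k'" "j < k" "j < k'" for s j k k'
    using that by (cases k k' rule: linorder_cases) (auto simp: A_def not_less[symmetric])
  have A_sum: "(\<Sum>k\<in>{j<..n}. indicator (A j k) s :: ennreal) \<le> 1" for j s
  proof -
    have "disjoint_family_on (A j) {j<..n}"
      using A_unique by (auto simp: disjoint_family_on_def)
    then have "(\<Sum>k\<in>{j<..n}. indicator (A j k) s :: ennreal) = indicator (\<Union>k\<in>{j<..n}. A j k) s"
      by (subst indicator_UN_disjoint) auto
    also have "\<dots> \<le> 1" by (simp add: indicator_def)
    finally show ?thesis .
  qed
  \<comment> \<open>Doob's maximal inequality: on \<open>A j k\<close> the conditional expectation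
    exceeds \<open>t\<close>, and the tower property turns the integral of \<open>U j k\<close> over
    \<open>A j k\<close> into that of \<open>H\<close>. Summing over disjoint events gives at most
    \<open>m / t\<close>, which is 1/4.\<close>
  have A_prob: "(\<Sum>k\<in>{j<..n}. emeasure S (A j k)) \<le> ennreal (1/4)" for j
  proof -
    have "ennreal t * emeasure S (A j k) \<le> (\<integral>\<^sup>+ s. H s * indicator (A j k) s \<partial>S)"
      if "k \<in> {j<..n}" for k
    proof -
      have "ennreal t * emeasure S (A j k) = (\<integral>\<^sup>+ s. ennreal t * indicator (A j k) s \<partial>S)"
        by (simp add: nn_integral_cmult_indicator)
      also have "\<dots> \<le> (\<integral>\<^sup>+ s. U j k s * indicator (A j k) s \<partial>S)"
        by (intro nn_integral_mono) (auto simp: A_def indicator_def)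
      also have "\<dots> = (\<integral>\<^sup>+ s. \<integral>\<^sup>+ z. H (resample n {j..<k} s z) *
          indicator (A j k) (resample n {j..<k} s z) \<partial>S \<partial>S)"
      proof (rule nn_integral_cong)
        fix s assume s: "s \<in> space S"
        have "(indicator (A j k) (resample n {j..<k} s z) :: ennreal) = indicator (A j k) s"
          if "z \<in> space S" for z
          using s that \<open>k \<in> _\<close>
          using A_cong[of "resample n {j..<k} s z" s j k] resample_in_space[of s n M z]
          by (auto simp: indicator_def resample_apply S_def)
        then have "(\<integral>\<^sup>+ z. H (resample n {j..<k} s z) *
            indicator (A j k) (resample n {j..<k} s z) \<partial>S)
          = (\<integral>\<^sup>+ z. H (resample n {j..<k} s z) * indicator (A j k) s \<partial>S)"
          by (intro nn_integral_cong) simp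
        also have "\<dots> = U j k s * indicator (A j k) s"
          using s by (simp add: U_def nn_integral_multc)
        finally show "U j k s * indicator (A j k) s = (\<integral>\<^sup>+ z. H (resample n {j..<k} s z) *
            indicator (A j k) (resample n {j..<k} s z) \<partial>S)" ..
      qed
      also have "\<dots> = (\<integral>\<^sup>+ s. H s * indicator (A j k) s \<partial>S)"
        unfolding S_def by (rule nn_integral_resample) (simp add: S_def[symmetric])
      finally show ?thesis .
    qed
    then have "ennreal t * (\<Sum>k\<in>{j<..n}. emeasure S (A j k))
        \<le> (\<Sum>k\<in>{j<..n}. \<integral>\<^sup>+ s. H s * indicator (A j k) s \<partial>S)"
      unfolding sum_distrib_left by (rule sum_mono)
    also have "\<dots> = (\<integral>\<^sup>+ s. H s * (\<Sum>k\<in>{j<..n}. indicator (A j k) s) \<partial>S)"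
      by (subst nn_integral_sum[symmetric]) (auto simp: sum_distrib_left)
    also have "\<dots> \<le> (\<integral>\<^sup>+ s. H s \<partial>S)"
      using mult_left_mono[OF A_sum, of "H _"] by (intro nn_integral_mono) simp
    also have "\<dots> \<le> ennreal m" using H_le by (simp add: S_def)
    finally have "ennreal t * (\<Sum>k\<in>{j<..n}. emeasure S (A j k)) \<le> ennreal m" .
    then show ?thesis
      using m by (simp add: S.emeasure_eq_measure sum_nonneg ennreal_mult[symmetric] t_def)
  qed
  \<comment> \<open>The invariant of a backward construction: \<open>W\<close> controls the sums
    from \<open>j\<close> to the end. The third clause makes it a function of the coordinates from
    \<open>j\<close> on, hence independent of a stop at \<open>j\<close>.\<close>
  define good where "good j W \<longleftrightarrow> W \<in> borel_measurable S \<and> (\<forall>s. 0 \<le> W s) \<and>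
    (\<forall>s\<in>space S. \<forall>s'\<in>space S. (\<forall>i. j \<le> i \<and> i < n \<longrightarrow> s i = s' i) \<longrightarrow> W s = W s') \<and>
    (\<forall>s\<in>space S. \<forall>\<xi>\<in>\<Xi>. \<bar>\<Sum>i\<in>{j..<n}. \<xi> (s i)\<bar> \<le> W s) \<and>
    (\<integral>\<^sup>+ s. ennreal ((W s)\<^sup>2) \<partial>S) \<le> ennreal (3 * (t + b)\<^sup>2)" for j and W :: "(nat \<Rightarrow> 'a) \<Rightarrow> real"
  \<comment> \<open>Strong induction on the number of remaining terms: after a stop at
    \<open>k > j\<close> the majorant of the tail from \<open>k\<close> takes over. For
    \<open>j = n\<close> the sum is empty and the majorant is the constant \<open>t\<close>.\<close>
  have "\<exists>W. good j W" if "j \<le> n" for j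
    using that
  proof (induction "n - j" arbitrary: j rule: less_induct)
    case less
    have "\<forall>k\<in>{j<..n}. \<exists>W. good k W"
      using less by auto
    then obtain w where w: "\<And>k. k \<in> {j<..n} \<Longrightarrow> good k (w k)"
      by metis
    \<comment> \<open>A stop at \<open>k\<close> costs \<open>t\<close> for the terms before the
      crossing one, \<open>b\<close> for the crossing one and \<open>w k s\<close> for the
      rest.\<close>
    define W where "W s = t + (\<Sum>k\<in>{j<..n}. indicator (A j k) s * (b + w k s))" for s
    have w_meas: "w k \<in> borel_measurable S" and w_nonneg: "0 \<le> w k s"
      and w_int: "(\<integral>\<^sup>+ s. ennreal ((w k s)\<^sup>2) \<partial>S) \<le> ennreal (3 * (t + b)\<^sup>2)"
      if "k \<in> {j<..n}" for k s
      using w[OF that] by (auto simp: good_def)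
    have w_cong: "w k s = w k s'"
      if "k \<in> {j<..n}" "s \<in> space S" "s' \<in> space S" "\<And>i. k \<le> i \<Longrightarrow> i < n \<Longrightarrow> s i = s' i" for k s s'
      using w[OF that(1)] that unfolding good_def by blast
    have w_ge: "\<bar>\<Sum>i\<in>{k..<n}. \<xi> (s i)\<bar> \<le> w k s"
      if "k \<in> {j<..n}" "s \<in> space S" "\<xi> \<in> \<Xi>" for k s \<xi>
      using w[OF that(1)] that unfolding good_def by blast
    have W_hit: "W s = t + b + w k s" if "s \<in> A j k" "k \<in> {j<..n}" for s k
    proof -
      have "(\<Sum>k'\<in>{j<..n}. indicator (A j k') s * (b + w k' s))
          = (\<Sum>k'\<in>{k}. indicator (A j k') s * (b + w k' s))"
        using that A_unique by (intro sum.mono_neutral_right) (auto simp: indicator_def)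
      then show ?thesis using that by (simp add: W_def)
    qed
    have W_miss: "W s = t" if "\<And>k. k \<in> {j<..n} \<Longrightarrow> s \<notin> A j k" for s
      using that by (simp add: W_def)
    have "good j W"
      unfolding good_def
    proof (intro conjI ballI allI impI)
      show "W \<in> borel_measurable S"
        unfolding W_def using w_meas by measurable
      show "0 \<le> W s" for s
        unfolding W_def using t b w_nonneg by (intro add_nonneg_nonneg sum_nonneg) auto
      show "W s = W s'"
        if "s \<in> space S" "s' \<in> space S" "\<forall>i. j \<le> i \<and> i < n \<longrightarrow> s i = s' i" for s s'
        unfolding W_def
      proof (intro arg_cong2[of _ _ _ _ "(+)"] sum.cong refl)
        fix k assume k: "k \<in> {j<..n}"
        have "w k s = w k s'" using that k by (intro w_cong) auto
        moreover have "s \<in> A j k \<longleftrightarrow> s' \<in> A j k" using that k by (intro A_cong) auto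
        ultimately show "indicator (A j k) s * (b + w k s) = indicator (A j k) s' * (b + w k s')"
          by (simp add: indicator_def)
      qed
      show "\<bar>\<Sum>i\<in>{j..<n}. \<xi> (s i)\<bar> \<le> W s" if s: "s \<in> space S" and \<xi>: "\<xi> \<in> \<Xi>" for s \<xi>
      proof (cases "\<exists>k\<in>{j<..n}. s \<in> A j k")
        case True
        then obtain k where k: "k \<in> {j<..n}" "s \<in> A j k" by blast
        \<comment> \<open>\<open>U j k\<close> sees the coordinates below \<open>k\<close>, so the
          crossing term has index \<open>k - 1\<close>. For \<open>l = j\<close> no term of the
          block precedes it.\<close>
        then obtain l where l: "k = Suc l" "j \<le> l" "l < n" by (cases k) auto
        have "\<bar>\<Sum>i\<in>{j..<l}. \<xi> (s i)\<bar> \<le> t"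
        proof (cases "j = l")
          case False
          then have "U j l s \<le> ennreal t" using k l by (auto simp: A_def)
          with U_ge[of \<xi> l s j] s \<xi> l have "ennreal \<bar>\<Sum>i\<in>{j..<l}. \<xi> (s i)\<bar> \<le> ennreal t"
            by (auto intro: order_trans)
          then show ?thesis using t by (simp add: ennreal_le_iff)
        qed (use t in auto)
        moreover have "\<bar>\<xi> (s l)\<bar> \<le> b"
          using s l \<xi> by (intro bound) (auto simp: S_def space_sample_law)
        moreover have "\<bar>\<Sum>i\<in>{k..<n}. \<xi> (s i)\<bar> \<le> w k s"
          using w_ge k s \<xi> by auto
        moreover have "(\<Sum>i\<in>{j..<n}. \<xi> (s i))
            = (\<Sum>i\<in>{j..<l}. \<xi> (s i)) + \<xi> (s l) + (\<Sum>i\<in>{k..<n}. \<xi> (s i))"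
          using l by (simp add: sum.atLeastLessThan_concat[of j l n, symmetric]
              sum.atLeast_Suc_lessThan[of l n])
        ultimately show ?thesis
          unfolding W_hit[OF k(2,1)] by linarith
      next
        case False
        have "\<bar>\<Sum>i\<in>{j..<n}. \<xi> (s i)\<bar> \<le> t"
        proof (cases "j = n")
          case jn: False
          \<comment> \<open>Without a stop every \<open>U j k s\<close> is at most \<open>t\<close>:
            the first one to exceed it would put \<open>s\<close> into \<open>A j k\<close>.\<close>
          have "U j k s \<le> ennreal t" if "k \<in> {j<..n}" for k
            using that
          proof (induction k rule: less_induct)
            case (less k)
            then have "\<forall>l\<in>{j<..<k}. U j l s \<le> ennreal t" by auto
            with False less.prems s show ?case by (auto simp: A_def not_less)
          qed
          from this[of n] jn less.prems have "U j n s \<le> ennreal t" by auto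
          with U_ge[of \<xi> n s j] s \<xi> have "ennreal \<bar>\<Sum>i\<in>{j..<n}. \<xi> (s i)\<bar> \<le> ennreal t"
            by (auto intro: order_trans)
          then show ?thesis using t by (simp add: ennreal_le_iff)
        qed (use t in auto)
        then show ?thesis using W_miss False by auto
      qed
      \<comment> \<open>A squared sum is at most twice the sum of the squares, here for the summands
        \<open>t + b\<close> and \<open>w k s\<close>.\<close>
      define V where "V k s = ennreal (2 * (t + b)\<^sup>2 + 2 * (w k s)\<^sup>2)" for k s
      have V_meas: "V k \<in> borel_measurable S" if "k \<in> {j<..n}" for k
        unfolding V_def using w_meas[OF that] by measurable
      have "ennreal ((W s)\<^sup>2) \<le> ennreal (t\<^sup>2) + (\<Sum>k\<in>{j<..n}. indicator (A j k) s * V k s)" for s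
      proof (cases "\<exists>k\<in>{j<..n}. s \<in> A j k")
        case True
        then obtain k where k: "k \<in> {j<..n}" "s \<in> A j k" by blast
        have "(W s)\<^sup>2 \<le> 2 * (t + b)\<^sup>2 + 2 * (w k s)\<^sup>2"
          unfolding W_hit[OF k(2,1)] using sum_squares_bound[of "t + b" "w k s"]
          by (simp add: power2_sum algebra_simps)
        then have "ennreal ((W s)\<^sup>2) \<le> indicator (A j k) s * V k s"
          using k by (simp add: V_def ennreal_leI del: ennreal_plus)
        also have "\<dots> \<le> (\<Sum>k\<in>{j<..n}. indicator (A j k) s * V k s)"
          using k by (intro member_le_sum) auto
        finally show ?thesis by (simp add: add_increasing)
      next
        case False
        then show ?thesis using W_miss by simp
      qed
      then have "(\<integral>\<^sup>+ s. ennreal ((W s)\<^sup>2) \<partial>S)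
          \<le> (\<integral>\<^sup>+ s. ennreal (t\<^sup>2) + (\<Sum>k\<in>{j<..n}. indicator (A j k) s * V k s) \<partial>S)"
        by (intro nn_integral_mono) auto
      also have "\<dots> = ennreal (t\<^sup>2) + (\<Sum>k\<in>{j<..n}. \<integral>\<^sup>+ s. indicator (A j k) s * V k s \<partial>S)"
        using V_meas
        by (subst nn_integral_add, simp, measurable, subst nn_integral_sum)
           (auto simp: S.emeasure_space_1)
      also have "(\<Sum>k\<in>{j<..n}. \<integral>\<^sup>+ s. indicator (A j k) s * V k s \<partial>S)
          \<le> (\<Sum>k\<in>{j<..n}. emeasure S (A j k) * ennreal (8 * (t + b)\<^sup>2))"
      proof (rule sum_mono)
        fix k assume k: "k \<in> {j<..n}"
        \<comment> \<open>\<open>A j k\<close> depends on coordinates below \<open>k\<close> and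
          \<open>V k\<close> on those from \<open>k\<close> on, so the expectation factors.\<close>
        have "(\<integral>\<^sup>+ s. indicator (A j k) s * V k s \<partial>S)
            = (\<integral>\<^sup>+ s. indicator (A j k) s \<partial>S) * (\<integral>\<^sup>+ s. V k s \<partial>S)"
          unfolding S_def
        proof (rule nn_integral_mult_indep[where I = "{..<k}"], unfold S_def[symmetric])
          show "indicator (A j k) s = (indicator (A j k) s' :: ennreal)"
            if "s \<in> space S" "s' \<in> space S" "\<And>i. i < n \<Longrightarrow> i \<in> {..<k} \<Longrightarrow> s i = s' i" for s s'
            using A_cong[of s s' j k] that k by (auto simp: indicator_def)
          show "V k s = V k s'"
            if "s \<in> space S" "s' \<in> space S" "\<And>i. i < n \<Longrightarrow> i \<notin> {..<k} \<Longrightarrow> s i = s' i" for s s'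
            using w_cong[of k s s'] that k by (auto simp: V_def)
        qed (use V_meas[OF k] in auto)
        also have "(\<integral>\<^sup>+ s. V k s \<partial>S) = ennreal (2 * (t + b)\<^sup>2) + 2 * (\<integral>\<^sup>+ s. ennreal ((w k s)\<^sup>2) \<partial>S)"
          unfolding V_def using w_meas[OF k]
          by (simp add: ennreal_plus ennreal_mult nn_integral_add nn_integral_cmult S.emeasure_space_1)
        also have "\<dots> \<le> ennreal (2 * (t + b)\<^sup>2) + 2 * ennreal (3 * (t + b)\<^sup>2)"
          using w_int[OF k] by (intro add_left_mono mult_left_mono) auto
        also have "\<dots> = ennreal (8 * (t + b)\<^sup>2)"
          by (simp add: ennreal_mult'[symmetric] ennreal_plus[symmetric] del: ennreal_plus
              flip: ennreal_numeral)
        finally show "(\<integral>\<^sup>+ s. indicator (A j k) s * V k s \<partial>S) \<le> emeasure S (A j k) * ennreal (8 * (t + b)\<^sup>2)"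
          by (simp add: mult_left_mono)
      qed
      also have "\<dots> = (\<Sum>k\<in>{j<..n}. emeasure S (A j k)) * ennreal (8 * (t + b)\<^sup>2)"
        by (simp add: sum_distrib_right)
      also have "\<dots> \<le> ennreal (1/4) * ennreal (8 * (t + b)\<^sup>2)"
        by (intro mult_right_mono A_prob) simp
      \<comment> \<open>The constant 3 reproduces itself: a stop contributes the factor 2 + 2 * 3 =
        8, its probability 1/4 reduces this to 2, and the square of \<open>t\<close> adds at most
        1.\<close>
      also have "ennreal (t\<^sup>2) + ennreal (1/4) * ennreal (8 * (t + b)\<^sup>2) = ennreal (t\<^sup>2 + 2 * (t + b)\<^sup>2)"
        by (simp add: ennreal_mult[symmetric] ennreal_plus[symmetric] del: ennreal_plus)
      also have "\<dots> \<le> ennreal (3 * (t + b)\<^sup>2)"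
        using t b power_mono[of t "t + b" 2] by (intro ennreal_leI) auto
      finally show "(\<integral>\<^sup>+ s. ennreal ((W s)\<^sup>2) \<partial>S) \<le> ennreal (3 * (t + b)\<^sup>2)"
        by (simp add: add_left_mono)
    qed
    then show ?case by blast
  qed
  from this[of 0] obtain W where W: "good 0 W" by blast
  show ?thesis
  proof (rule that[of W])
    show "W \<in> borel_measurable (sample_law n M)" "0 \<le> W s" for s
      using W by (auto simp: good_def S_def)
    show "\<bar>\<Sum>i<n. \<xi> (s i)\<bar> \<le> W s" if "s \<in> space (sample_law n M)" "\<xi> \<in> \<Xi>" for s \<xi>
      using W that unfolding good_def S_def atLeast0LessThan by blast
    show "(\<integral>\<^sup>+ s. ennreal ((W s)\<^sup>2) \<partial>sample_law n M) \<le> ennreal (3 * (4 * m + b)\<^sup>2)"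
      using W unfolding good_def S_def t_def by blast
  qed
qed

end

section \<open>Outer expectations and the empirical process\<close>

lemma outer_expectation_le:
  assumes "H \<in> borel_measurable N" and "\<And>x. x \<in> space N \<Longrightarrow> F x \<le> H x"
  shows "outer_expectation N F \<le> (\<integral>\<^sup>+ x. H x \<partial>N)"
  unfolding outer_expectation_def using assms by (intro INF_lower) auto

lemma outer_expectation_less_obtain:
  assumes "outer_expectation N F < c"
  obtains H where "H \<in> borel_measurable N" "\<And>x. x \<in> space N \<Longrightarrow> F x \<le> H x"
    "(\<integral>\<^sup>+ x. H x \<partial>N) < c"
  using assms unfolding outer_expectation_def by (auto simp: INF_less_iff)

text \<open>Applies the stopping bound to the centred functions divided by \<open>n\<close>: their
  sum over the sample is the deviation of the empirical mean, up to sign, and each is at most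
  \<open>2 * B / n\<close>.\<close>

lemma (in prob_space) empirical_process_second_moment:
  fixes m B :: real and F :: "('a \<Rightarrow> real) set"
  assumes meas: "\<And>h. h \<in> F \<Longrightarrow> h \<in> borel_measurable M"
    and bound: "\<And>h w. h \<in> F \<Longrightarrow> w \<in> space M \<Longrightarrow> \<bar>h w\<bar> \<le> B"
    and sup: "outer_expectation (sample_law n M)
      (\<lambda>s. SUP h\<in>F. ennreal \<bar>(\<integral>w. h w \<partial>M) - emp_mean n s h\<bar>) \<le> ennreal m"
    and m: "0 < m" and B: "0 \<le> B" and n: "1 \<le> n"
  obtains W where "W \<in> borel_measurable (sample_law n M)" "\<And>s. 0 \<le> W s"
    "\<And>s h. s \<in> space (sample_law n M) \<Longrightarrow> h \<in> F \<Longrightarrow> \<bar>(\<integral>w. h w \<partial>M) - emp_mean n s h\<bar> \<le> W s"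
    "(\<integral>\<^sup>+ s. ennreal ((W s)\<^sup>2) \<partial>sample_law n M) \<le> ennreal (3 * (8 * m + 2 * B / real n)\<^sup>2)"
proof -
  \<comment> \<open>The infimum defining the outer expectation need not be attained. As
    \<open>m\<close> is positive, a measurable majorant of mean below \<open>2 * m\<close> exists;
    this turns \<open>4 * m\<close> into \<open>8 * m\<close>.\<close>
  have "outer_expectation (sample_law n M)
      (\<lambda>s. SUP h\<in>F. ennreal \<bar>(\<integral>w. h w \<partial>M) - emp_mean n s h\<bar>) < ennreal (2 * m)"
    using m by (intro le_less_trans[OF sup]) (simp add: ennreal_lessI)
  then obtain H where H: "H \<in> borel_measurable (sample_law n M)"
    "\<And>s. s \<in> space (sample_law n M) \<Longrightarrow>
      (SUP h\<in>F. ennreal \<bar>(\<integral>w. h w \<partial>M) - emp_mean n s h\<bar>) \<le> H s"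
    "(\<integral>\<^sup>+ s. H s \<partial>sample_law n M) < ennreal (2 * m)"
    by (rule outer_expectation_less_obtain) blast
  define \<xi> where "\<xi> h w = (h w - (\<integral>w. h w \<partial>M)) / real n" for h w
  have int: "integrable M h" if "h \<in> F" for h
    using meas[OF that] bound[OF that] by (intro integrable_const_bound[where B = B]) auto
  have sum: "(\<Sum>i<n. \<xi> h (s i)) = emp_mean n s h - (\<integral>w. h w \<partial>M)" for h s
    using n by (simp add: \<xi>_def emp_mean_def sum_divide_distrib[symmetric] sum_subtractf
        diff_divide_distrib)
  have mean: "\<bar>\<integral>w. h w \<partial>M\<bar> \<le> B" if "h \<in> F" for h
  proof -
    have "norm (\<integral>w. h w \<partial>M) \<le> (\<integral>w. norm (h w) \<partial>M)"
      by (rule integral_norm_bound)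
    also have "\<dots> \<le> (\<integral>w. B \<partial>M)"
      using int[OF that] bound[OF that] by (intro integral_mono) auto
    finally show ?thesis by (simp add: prob_space)
  qed
  obtain W where W: "W \<in> borel_measurable (sample_law n M)" "\<And>s. 0 \<le> W s"
    "\<And>s \<eta>. s \<in> space (sample_law n M) \<Longrightarrow> \<eta> \<in> \<xi> ` F \<Longrightarrow> \<bar>\<Sum>i<n. \<eta> (s i)\<bar> \<le> W s"
    "(\<integral>\<^sup>+ s. ennreal ((W s)\<^sup>2) \<partial>sample_law n M) \<le> ennreal (3 * (4 * (2 * m) + 2 * B / real n)\<^sup>2)"
  proof (rule second_moment_majorant[of "\<xi> ` F" "2 * B / real n" H n "2 * m"])
    fix \<eta> assume "\<eta> \<in> \<xi> ` F"
    then obtain h where h: "h \<in> F" "\<eta> = \<xi> h" by auto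
    show "\<eta> \<in> borel_measurable M"
      using meas[OF h(1)] unfolding h(2) \<xi>_def by measurable
    show "(\<integral>w. \<eta> w \<partial>M) = 0"
      using int[OF h(1)] by (simp add: h(2) \<xi>_def prob_space)
    show "\<bar>\<eta> w\<bar> \<le> 2 * B / real n" if "w \<in> space M" for w
      using bound[OF h(1) that] mean[OF h(1)] n
      by (auto simp: h(2) \<xi>_def abs_divide intro!: divide_right_mono)
    show "ennreal \<bar>\<Sum>i<n. \<eta> (s i)\<bar> \<le> H s" if "s \<in> space (sample_law n M)" for s
    proof -
      have "ennreal \<bar>\<Sum>i<n. \<eta> (s i)\<bar> = ennreal \<bar>(\<integral>w. h w \<partial>M) - emp_mean n s h\<bar>"
        unfolding h(2) sum by (simp add: abs_minus_commute)
      also have "\<dots> \<le> (SUP h\<in>F. ennreal \<bar>(\<integral>w. h w \<partial>M) - emp_mean n s h\<bar>)"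
        by (rule SUP_upper[OF h(1)])
      finally show ?thesis using H(2)[OF that] by (rule order_trans)
    qed
  qed (use H m B in auto)
  show ?thesis
  proof (rule that[of W])
    fix s h assume "s \<in> space (sample_law n M)" "h \<in> F"
    then have "\<bar>\<Sum>i<n. \<xi> h (s i)\<bar> \<le> W s" by (intro W) auto
    then show "\<bar>(\<integral>w. h w \<partial>M) - emp_mean n s h\<bar> \<le> W s"
      unfolding sum by (simp add: abs_minus_commute)
  qed (use W in auto)
qed

section \<open>Peeling over dyadic shells\<close>

text \<open>A value of \<open>E\<close> not absorbed by the deterministic part is comparable to some
  \<open>2 ^ j * \<epsilon>\<close> and at most a multiple of \<open>W j s\<close>. So it is at most
  a multiple of the square of \<open>W j s\<close> divided by the shell level, and summing over all
  \<open>j\<close> gives a measurable majorant.\<close>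

lemma outer_expectation_peeling:
  fixes E :: "'s \<Rightarrow> real" and W :: "nat \<Rightarrow> 's \<Rightarrow> real" and \<epsilon> \<theta> c B x R0 :: real
  assumes "prob_space S" and \<epsilon>: "0 < \<epsilon>" and \<theta>: "0 < \<theta>" and c: "0 \<le> c" and B: "0 \<le> B"
    and x: "0 \<le> x" "x < 2" and R0: "0 \<le> R0"
    and W_meas [measurable]: "\<And>j. W j \<in> borel_measurable S"
    and W_nonneg: "\<And>j s. 0 \<le> W j s"
    and W_int: "\<And>j. (\<integral>\<^sup>+ s. ennreal ((W j s)\<^sup>2) \<partial>S) \<le> ennreal (B * \<epsilon>\<^sup>2 * x ^ j)"
    and local: "\<And>j s. s \<in> space S \<Longrightarrow> E s \<le> 2 ^ j * \<epsilon> \<Longrightarrow> \<theta> * E s \<le> c * \<epsilon> + W j s"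
  shows "outer_expectation S (\<lambda>s. ennreal (R0 + E s))
    \<le> ennreal (R0 + (1 + 2 * c / \<theta> + 8 * B / \<theta>\<^sup>2 / (1 - x / 2)) * \<epsilon>)"
proof -
  interpret prob_space S by fact
  define T where "T j s = ennreal (8 / (\<theta>\<^sup>2 * 2 ^ j * \<epsilon>)) * ennreal ((W j s)\<^sup>2)" for j s
  \<comment> \<open>\<open>D\<close> covers the bottom shell and the values for which
    \<open>c * \<epsilon>\<close> is at least half of \<open>\<theta> * E s\<close>.\<close>
  define D where "D = R0 + \<epsilon> + 2 * c / \<theta> * \<epsilon>"
  have D: "0 \<le> D" using R0 \<epsilon> c \<theta> by (simp add: D_def)
  have "ennreal (R0 + E s) \<le> ennreal D + (\<Sum>j. T j s)" if s: "s \<in> space S" for s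
  proof (cases "R0 + E s \<le> D")
    case True
    then show ?thesis by (simp add: ennreal_leI add_increasing2)
  next
    case False
    have "0 \<le> 2 * c / \<theta> * \<epsilon>" using c \<theta> \<epsilon> by simp
    with False have E: "\<epsilon> < E s" and E2: "2 * c / \<theta> * \<epsilon> < E s"
      using \<epsilon> by (simp_all add: D_def)
    have "\<exists>j. E s \<le> 2 ^ j * \<epsilon>"
      using real_arch_pow[of 2 "E s / \<epsilon>"] \<epsilon> by (auto simp: field_simps intro: less_imp_le)
    \<comment> \<open>By minimality of \<open>j\<close>, which is positive since
      \<open>E s > \<epsilon>\<close>, the value also exceeds half the shell level.\<close>
    then obtain j where j: "E s \<le> 2 ^ j * \<epsilon>" "\<And>i. i < j \<Longrightarrow> \<not> E s \<le> 2 ^ i * \<epsilon>"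
      using exists_least_iff[of "\<lambda>j. E s \<le> 2 ^ j * \<epsilon>"] by blast
    with E have "j \<noteq> 0" by (intro notI) auto
    with j(2)[of "j - 1"] have up: "2 ^ j * \<epsilon> \<le> 2 * E s" by (cases j) auto
    have "\<theta> * E s \<le> c * \<epsilon> + W j s" using local s j by blast
    moreover have "2 * (c * \<epsilon>) < \<theta> * E s" using E2 \<theta> by (simp add: field_simps)
    ultimately have "\<theta> * E s \<le> 2 * W j s" by linarith
    then have "(\<theta> * E s)\<^sup>2 \<le> (2 * W j s)\<^sup>2"
      using \<theta> E \<epsilon> by (intro power_mono) auto
    then have "\<theta>\<^sup>2 * (E s * E s) \<le> 4 * (W j s)\<^sup>2"
      by (simp add: power2_eq_square mult_ac)
    moreover have "\<theta>\<^sup>2 * (E s * (2 ^ j * \<epsilon>)) \<le> \<theta>\<^sup>2 * (E s * (2 * E s))"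
      using up \<theta> E \<epsilon> by (intro mult_left_mono) auto
    \<comment> \<open>The 8 is 4 from squaring \<open>2 * W j s\<close> times 2 from the width of
      the shell.\<close>
    ultimately have "E s * (\<theta>\<^sup>2 * 2 ^ j * \<epsilon>) \<le> 8 * (W j s)\<^sup>2"
      by (simp add: mult_ac)
    then have "E s \<le> 8 / (\<theta>\<^sup>2 * 2 ^ j * \<epsilon>) * (W j s)\<^sup>2"
      using \<theta> \<epsilon> by (simp add: field_simps)
    then have "ennreal (E s) \<le> T j s"
      using \<theta> \<epsilon> by (simp add: T_def ennreal_mult[symmetric] ennreal_leI)
    also have "\<dots> \<le> (\<Sum>j. T j s)"
      using sum_le_suminf[of "\<lambda>j. T j s" "{j}"] by simp
    finally have "ennreal (E s) \<le> (\<Sum>j. T j s)" .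
    moreover have "ennreal R0 \<le> ennreal D"
      using c \<theta> \<epsilon> by (intro ennreal_leI) (simp add: D_def)
    ultimately show ?thesis
      using R0 E \<epsilon> by (simp add: add_mono)
  qed
  then have "outer_expectation S (\<lambda>s. ennreal (R0 + E s)) \<le> (\<integral>\<^sup>+ s. ennreal D + (\<Sum>j. T j s) \<partial>S)"
    unfolding T_def by (intro outer_expectation_le) auto
  also have "\<dots> = ennreal D + (\<Sum>j. \<integral>\<^sup>+ s. T j s \<partial>S)"
    unfolding T_def by (simp add: nn_integral_add nn_integral_suminf emeasure_space_1)
  also have "\<dots> \<le> ennreal D + (\<Sum>j. ennreal (8 * B / \<theta>\<^sup>2 * \<epsilon> * (x / 2) ^ j))"
  proof (intro add_left_mono suminf_le)
    fix j
    have "(\<integral>\<^sup>+ s. T j s \<partial>S) \<le> ennreal (8 / (\<theta>\<^sup>2 * 2 ^ j * \<epsilon>)) * ennreal (B * \<epsilon>\<^sup>2 * x ^ j)"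
      unfolding T_def by (simp add: nn_integral_cmult mult_left_mono W_int)
    \<comment> \<open>The shell level cancels one factor \<open>\<epsilon>\<close> of the second
      moment and leaves a geometric series of ratio \<open>x / 2 < 1\<close>.\<close>
    also have "\<dots> = ennreal (8 * B / \<theta>\<^sup>2 * \<epsilon> * (x / 2) ^ j)"
      using \<theta> \<epsilon> B x by (simp add: ennreal_mult[symmetric] power2_eq_square power_divide)
    finally show "(\<integral>\<^sup>+ s. T j s \<partial>S) \<le> ennreal (8 * B / \<theta>\<^sup>2 * \<epsilon> * (x / 2) ^ j)" .
  qed auto
  also have "(\<Sum>j. ennreal (8 * B / \<theta>\<^sup>2 * \<epsilon> * (x / 2) ^ j)) = ennreal (8 * B / \<theta>\<^sup>2 * \<epsilon> * (1 / (1 - x / 2)))"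
    using B \<epsilon> \<theta> x by (intro suminf_ennreal_eq sums_mult geometric_sums) auto
  also have "ennreal D + \<dots> = ennreal (D + 8 * B / \<theta>\<^sup>2 * \<epsilon> * (1 / (1 - x / 2)))"
    using D B \<epsilon> \<theta> x by (intro ennreal_plus[symmetric]) auto
  also have "D + 8 * B / \<theta>\<^sup>2 * \<epsilon> * (1 / (1 - x / 2))
      = R0 + (1 + 2 * c / \<theta> + 8 * B / \<theta>\<^sup>2 / (1 - x / 2)) * \<epsilon>"
    by (simp add: D_def algebra_simps)
  finally show ?thesis .
qed

section \<open>Norms, measurability and integrability in the model\<close>

lemma L2_norm_le_of_sq:
  assumes "(L2_norm N h)\<^sup>2 \<le> ennreal (\<delta>\<^sup>2)" and "0 \<le> \<delta>"
  shows "L2_norm N h \<le> ennreal \<delta>"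
proof (cases "L2_norm N h")
  case (real l)
  then show ?thesis
    using assms by (auto simp: ennreal_power intro!: ennreal_leI power2_le_imp_le[of l \<delta>])
next
  case top
  then show ?thesis using assms by (simp add: top_power_ennreal top_unique)
qed

text \<open>Labels take countably many values, so measurability can be checked one label at a time;
  this serves both the loss and the smoothed loss.\<close>

lemma measurable_pair_count_space:
  assumes "countable A" and "\<And>y. y \<in> A \<Longrightarrow> (\<lambda>x. f (x, y)) \<in> measurable N K"
  shows "f \<in> measurable (N \<Otimes>\<^sub>M count_space A) K"
proof -
  have "(\<lambda>p. f (fst p, snd p)) \<in> measurable (N \<Otimes>\<^sub>M count_space A) K"
  proof (rule measurable_compose_countable'[where f = "\<lambda>y p. f (fst p, y)" and g = snd and I = A])
    show "(\<lambda>p. f (fst p, y)) \<in> measurable (N \<Otimes>\<^sub>M count_space A) K" if "y \<in> A" for y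
      by (rule measurable_compose[OF measurable_fst assms(2)[OF that]])
  qed (rule measurable_snd, rule assms(1))
  then show ?thesis by simp
qed

context inverse_learning
begin

lemma space_P: "space P = X \<times> {0..M}"
  using sets_eq_imp_space_eq[OF P_sets] X_sets[THEN sets.sets_into_space]
  by (simp add: space_pair_measure space_restrict_space Int_absorb2)

lemma measurable_loss_of:
  assumes loss: "loss_function M loss" and g: "g \<in> borel_measurable (restrict_space (Rd d) X)"
  shows "loss_of loss g \<in> borel_measurable P"
proof -
  have "(\<lambda>(x, y). loss (g x) y) \<in> borel_measurable (restrict_space (Rd d) X \<Otimes>\<^sub>M count_space {0..M})"
  proof (rule measurable_pair_count_space)
    fix y assume "y \<in> {0..M}"
    then have "(\<lambda>u. loss u y) \<in> borel_measurable borel" using loss by (simp add: loss_function_def)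
    from measurable_compose[OF g this]
    show "(\<lambda>x. case (x, y) of (x, y) \<Rightarrow> loss (g x) y) \<in> borel_measurable (restrict_space (Rd d) X)"
      by simp
  qed simp
  then show ?thesis
    unfolding loss_of_def measurable_cong_sets[OF P_sets refl] .
qed

lemma loss_of_bounds:
  assumes "loss_function M loss" and "w \<in> space P"
  shows "0 \<le> loss_of loss g w" and "loss_of loss g w \<le> 1"
  using assms by (auto simp: loss_function_def loss_of_def space_P)

lemma integrable_loss_of:
  assumes "loss_function M loss" and "g \<in> borel_measurable (restrict_space (Rd d) X)"
  shows "integrable P (loss_of loss g)"
proof -
  interpret prob_space P by (rule P_prob)
  show ?thesis
    using measurable_loss_of[OF assms] loss_of_bounds[OF assms(1)]
    by (intro integrable_const_bound[where B = 1]) (auto intro!: AE_I2)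
qed

text \<open>For a fixed label this is a parameter integral of a jointly measurable integrand over a
  sigma-finite measure.\<close>

lemma measurable_smooth_loss:
  assumes loss: "loss_function M loss" and G: "G \<subseteq> borel_measurable (restrict_space (Rd d) X)"
    and k: "admissible_kernel (restrict_space \<nu> X) (restrict_space \<nu> Xt) M loss G kl"
    and g: "g \<in> G"
  shows "smooth_loss (restrict_space \<nu> X) kl loss g \<in> borel_measurable Pt"
proof -
  let ?N = "restrict_space \<nu> X" and ?N' = "restrict_space \<nu> Xt"
  interpret N: sigma_finite_measure ?N
    using X_sets by (intro sigma_finite_measure_restrict_space nu_sigma_finite) (simp add: nu_sets)
  have sets_N: "sets ?N = sets (restrict_space (Rd d) X)"
    and sets_N': "sets ?N' = sets (restrict_space (Rd d) Xt)"
    by (auto intro!: sets_restrict_space_cong nu_sets)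
  have g_meas: "g \<in> borel_measurable ?N"
    using g G measurable_cong_sets[OF sets_N refl] by blast
  have "(\<lambda>(z, y). \<integral>x. loss (g x) y * kl z x \<partial>?N)
      \<in> borel_measurable (restrict_space (Rd d) Xt \<Otimes>\<^sub>M count_space {0..M})"
  proof (rule measurable_pair_count_space)
    fix y assume "y \<in> {0..M}"
    then have "(\<lambda>u. loss u y) \<in> borel_measurable borel" using loss by (simp add: loss_function_def)
    from measurable_compose[OF g_meas this]
    have "(\<lambda>p. loss (g (snd p)) y) \<in> borel_measurable (?N' \<Otimes>\<^sub>M ?N)"
      by (rule measurable_compose[OF measurable_snd])
    moreover have "(\<lambda>(z, x). kl z x) \<in> borel_measurable (?N' \<Otimes>\<^sub>M ?N)"
      using k by (simp add: admissible_kernel_def)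
    ultimately have "(\<lambda>(z, x). loss (g x) y * kl z x) \<in> borel_measurable (?N' \<Otimes>\<^sub>M ?N)"
      by (simp add: case_prod_beta')
    then have "(\<lambda>z. \<integral>x. loss (g x) y * kl z x \<partial>?N) \<in> borel_measurable ?N'"
      by (rule N.borel_measurable_lebesgue_integral)
    then show "(\<lambda>z. case (z, y) of (z, y) \<Rightarrow> \<integral>x. loss (g x) y * kl z x \<partial>?N)
        \<in> borel_measurable (restrict_space (Rd d) Xt)"
      unfolding measurable_cong_sets[OF sets_N' refl] by simp
  qed simp
  then show ?thesis
    unfolding smooth_loss_def measurable_cong_sets[OF Pt_sets refl] .
qed

end

text \<open>Identifies the smoothed risk, an average over samples of size \<open>n\<close>, with one
  integral against the law of an observation. At \<open>n = 0\<close> the empirical mean takes the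
  default value 0.\<close>

lemma (in prob_space) expectation_emp_mean:
  assumes "integrable M h" and "1 \<le> n"
  shows "(\<integral>s. emp_mean n s h \<partial>sample_law n M) = (\<integral>w. h w \<partial>M)"
proof -
  have h: "h \<in> borel_measurable M" using assms(1) by simp
  have "integrable (sample_law n M) (\<lambda>s. h (s i))" "(\<integral>s. h (s i) \<partial>sample_law n M) = (\<integral>w. h w \<partial>M)"
    if "i < n" for i
    using integrable_distr_eq[OF measurable_sample_component[OF that, of M] h]
      integral_distr[OF measurable_sample_component[OF that, of M] h] assms(1)
    by (simp_all add: distr_sample_component[OF that])
  then show ?thesis
    using assms(2) by (simp add: emp_mean_def)
qed

lemma emp_mean_diff: "emp_mean n s (\<lambda>w. h w - h' w) = emp_mean n s h - emp_mean n s h'"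
  by (simp add: emp_mean_def sum_subtractf diff_divide_distrib)

section \<open>Exponent arithmetic of the rate\<close>

text \<open>With \<open>q = 2 * \<kappa> + \<rho> - 1\<close>, the exponent of \<open>n\<close> on
  the left is \<open>1 - \<kappa> / q\<close>. The condition on \<open>K\<close> thus bounds it by
  the rate times \<open>n / (1 + ln n)\<close>.\<close>

lemma powr_rate:
  fixes c \<kappa> \<rho> :: real
  assumes "0 < c" and "1 < \<kappa>" and "0 < \<rho>" and "1 \<le> n"
  shows "c powr (2 * \<kappa> / (2 * \<kappa> + \<rho> - 1)) * real n powr ((\<kappa> + \<rho> - 1) / (2 * \<kappa> + \<rho> - 1))
    = (c / sqrt n) powr (2 * \<kappa> / (2 * \<kappa> + \<rho> - 1)) * real n"
proof -
  define q where "q = 2 * \<kappa> + \<rho> - 1"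
  have q: "0 < q" using assms by (simp add: q_def)
  have "sqrt n powr (2 * \<kappa> / q) = real n powr (\<kappa> / q)"
    using assms by (simp add: powr_half_sqrt[symmetric] powr_powr)
  moreover have "real n powr ((\<kappa> + \<rho> - 1) / q) = real n powr (- (\<kappa> / q)) * real n powr 1"
    using q unfolding powr_add[symmetric] by (simp add: q_def field_simps)
  moreover have "(c / sqrt n) powr (2 * \<kappa> / q) = c powr (2 * \<kappa> / q) / sqrt n powr (2 * \<kappa> / q)"
    using assms by (simp add: powr_divide)
  ultimately show ?thesis
    using assms by (simp add: q_def[symmetric] powr_minus divide_inverse)
qed

text \<open>The rate is a fixed point of the map sending \<open>\<epsilon>\<close> to
  \<open>c * \<epsilon> powr ((1 - \<rho>) / (2 * \<kappa>))\<close>. At the radius that the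
  Bernstein condition assigns to shell \<open>j\<close>, the modulus is therefore of the order of
  the rate times a geometric factor. In use, \<open>c / sqrt n\<close> stands for \<open>c\<close>
  and \<open>\<kappa>0 + 1\<close> for \<open>D\<close>.\<close>

lemma modulus_at_shell:
  fixes c \<kappa> \<rho> \<epsilon> D :: real
  assumes c: "0 < c" and \<kappa>: "1 < \<kappa>" and \<rho>: "0 < \<rho>" "\<rho> < 1" and D: "0 < D"
    and \<epsilon>: "\<epsilon> = c powr (2 * \<kappa> / (2 * \<kappa> + \<rho> - 1))"
  shows "c * (sqrt D * (2 ^ j * \<epsilon>) powr (1 / (2 * \<kappa>))) powr (1 - \<rho>)
    = D powr ((1 - \<rho>) / 2) * \<epsilon> * (2 powr ((1 - \<rho>) / (2 * \<kappa>))) ^ j"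
proof -
  define \<beta> where "\<beta> = (1 - \<rho>) / (2 * \<kappa>)"
  have \<epsilon>_pos: "0 < \<epsilon>" using \<epsilon> c by simp
  have q: "0 < 2 * \<kappa> + \<rho> - 1" using \<kappa> \<rho> by simp
  \<comment> \<open>\<open>1 - \<beta>\<close> is the reciprocal of the exponent that defines
    \<open>\<epsilon>\<close>.\<close>
  have "1 - \<beta> = (2 * \<kappa> + \<rho> - 1) / (2 * \<kappa>)"
    using \<kappa> by (simp add: \<beta>_def field_simps)
  then have "2 * \<kappa> / (2 * \<kappa> + \<rho> - 1) * (1 - \<beta>) = 1"
    using q \<kappa> by simp
  then have "\<epsilon> powr (1 - \<beta>) = c powr 1"
    unfolding \<epsilon> powr_powr by (rule arg_cong)
  then have "\<epsilon> powr (1 - \<beta>) = c"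
    using c by simp
  then have c_eq: "c * \<epsilon> powr \<beta> = \<epsilon>"
    using powr_add[of \<epsilon> "1 - \<beta>" \<beta>] \<epsilon>_pos by simp
  have dyadic: "(2 ^ j) powr \<beta> = (2 powr \<beta>) ^ j"
    by (simp add: powr_realpow[symmetric] powr_powr mult.commute)
  have "(sqrt D * (2 ^ j * \<epsilon>) powr (1 / (2 * \<kappa>))) powr (1 - \<rho>)
      = D powr ((1 - \<rho>) / 2) * ((2 ^ j) powr \<beta> * \<epsilon> powr \<beta>)"
    using D \<epsilon>_pos by (simp add: powr_mult powr_powr powr_half_sqrt[symmetric] \<beta>_def)
  then have "c * (sqrt D * (2 ^ j * \<epsilon>) powr (1 / (2 * \<kappa>))) powr (1 - \<rho>)
      = D powr ((1 - \<rho>) / 2) * (c * \<epsilon> powr \<beta>) * (2 powr \<beta>) ^ j"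
    unfolding dyadic by (simp only: mult_ac)
  then show ?thesis
    by (simp only: c_eq \<beta>_def[symmetric])
qed

section \<open>The risk bound at a fixed sample size\<close>

text \<open>Peeling is fed with one second moment bound per shell: \<open>x\<close> is the growth of
  that bound from a shell to the next, and \<open>B\<close> its scale relative to the squared
  rate.\<close>

lemma (in inverse_learning) excess_risk_bound:
  fixes C1 C2 \<kappa> \<kappa>0 \<rho> r c K a :: real
  defines "q \<equiv> 2 * \<kappa> / (2 * \<kappa> + \<rho> - 1)"
    and "x \<equiv> 2 powr ((1 - \<rho>) / \<kappa>)"
    and "B \<equiv> 3 * (8 * (C2 * (\<kappa>0 + 1) powr ((1 - \<rho>) / 2)) + 4)\<^sup>2"
  assumes C1: "0 < C1" and C2: "0 < C2" and \<kappa>: "1 < \<kappa>" and \<kappa>0: "0 \<le> \<kappa>0"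
    and \<rho>: "0 < \<rho>" "\<rho> < 1" and r: "0 < r" "r < 1"
    and loss: "loss_function M loss" and G: "G \<subseteq> borel_measurable (restrict_space (Rd d) X)"
    and gs: "is_arg_min (risk P loss) (\<lambda>g. g \<in> G) gs"
    and bernstein: "bernstein_class P \<mu> \<kappa> \<kappa>0 ((\<lambda>g w. loss_of loss g w - loss_of loss gs w) ` G)"
    and n: "1 \<le> n"
    and kernel: "admissible_kernel (restrict_space \<nu> X) (restrict_space \<nu> Xt) M loss G kl"
    and LB: "LB_class (restrict_space \<nu> X) kl loss Pt \<mu> G c K"
    and approx: "approximation_function (restrict_space \<nu> X) kl loss P Pt n G gs a r"
    and a: "a \<le> C1 * (c / sqrt n) powr q"
    and K: "K \<le> c powr q * real n powr ((\<kappa> + \<rho> - 1) / (2 * \<kappa> + \<rho> - 1)) / (1 + ln n)"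
    and modulus: "\<And>\<delta>. 0 < \<delta> \<Longrightarrow> modulus (restrict_space \<nu> X) kl loss Pt n G \<delta> \<mu>
      \<le> ennreal (C2 * (c / sqrt n) * \<delta> powr (1 - \<rho>))"
    and ghat: "\<And>s. s \<in> space (sample_law n Pt) \<Longrightarrow>
      is_arg_min (emp_smooth_risk (restrict_space \<nu> X) kl loss n s) (\<lambda>g. g \<in> G) (ghat s)"
  shows "outer_expectation (sample_law n Pt) (\<lambda>s. ennreal (risk P loss (ghat s)))
    \<le> ennreal (risk P loss gs
        + (1 + 2 * C1 / (1 - r) + 8 * B / (1 - r)\<^sup>2 / (1 - x / 2)) * (c / sqrt n) powr q)"
proof -
  interpret P: prob_space P by (rule P_prob)
  interpret Pt: prob_space Pt by (rule Pt_prob)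
  interpret S: prob_space "sample_law n Pt" by (rule Pt.prob_space_sample_law)
  define \<epsilon> where "\<epsilon> = (c / sqrt n) powr q"
  define E where "E g = risk P loss g - risk P loss gs" for g
  define sl where "sl = smooth_loss (restrict_space \<nu> X) kl loss"
  define \<Delta> where "\<Delta> g s = (\<integral>w. sl g w - sl gs w \<partial>Pt) - emp_mean n s (\<lambda>w. sl g w - sl gs w)" for g s
  have gs_min: "0 \<le> E g" if "g \<in> G" for g
    using gs that by (auto simp: is_arg_min_def E_def not_less)
  have ghat_in: "ghat s \<in> G" if "s \<in> space (sample_law n Pt)" for s
    using ghat[OF that] by (simp add: is_arg_min_def)
  have gs_in: "gs \<in> G" using gs by (simp add: is_arg_min_def)
  have R0: "0 \<le> risk P loss gs"
    unfolding risk_def using loss_of_bounds[OF loss] by (intro integral_nonneg_AE) auto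
  have c_nonneg: "0 \<le> c" and K_bound: "\<And>g w. g \<in> G \<Longrightarrow> w \<in> space Pt \<Longrightarrow> \<bar>sl g w\<bar> \<le> K"
    using LB by (auto simp: LB_class_def sl_def)
  obtain w where "w \<in> space Pt" using Pt.not_empty by blast
  from K_bound[OF gs_in this] have K_nonneg: "0 \<le> K" by linarith
  have sl_meas: "sl g \<in> borel_measurable Pt" if "g \<in> G" for g
    unfolding sl_def by (rule measurable_smooth_loss[OF loss G kernel that])
  have sl_int: "integrable Pt (sl g)" if "g \<in> G" for g
    using sl_meas[OF that] K_bound[OF that]
    by (intro Pt.integrable_const_bound[where B = K]) (auto intro!: AE_I2)
  have smooth_risk: "smooth_risk (restrict_space \<nu> X) kl loss Pt n g = (\<integral>w. sl g w \<partial>Pt)" if "g \<in> G" for g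
    unfolding smooth_risk_def emp_smooth_risk_def sl_def[symmetric]
    by (rule Pt.expectation_emp_mean[OF sl_int[OF that] n])
  \<comment> \<open>The estimator does at least as well as \<open>gs\<close> empirically, so the
    mean increment of its smoothed loss is at most \<open>\<Delta>\<close>. The approximation
    function converts this into excess risk, and the multiple \<open>r\<close> moves to the
    left.\<close>
  have basic: "(1 - r) * E (ghat s) \<le> a + \<Delta> (ghat s) s" if s: "s \<in> space (sample_law n Pt)" for s
  proof -
    have "emp_mean n s (sl (ghat s)) \<le> emp_mean n s (sl gs)"
      using ghat[OF s] gs_in by (auto simp: is_arg_min_def emp_smooth_risk_def sl_def not_less)
    moreover have "E (ghat s) - (\<integral>w. sl (ghat s) w \<partial>Pt) + (\<integral>w. sl gs w \<partial>Pt) \<le> a + r * E (ghat s)"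
      using approx ghat_in[OF s] gs_in
      by (auto simp: approximation_function_def smooth_risk[symmetric] E_def)
    moreover have "(\<integral>w. sl (ghat s) w - sl gs w \<partial>Pt) = (\<integral>w. sl (ghat s) w \<partial>Pt) - (\<integral>w. sl gs w \<partial>Pt)"
      using ghat_in[OF s] gs_in by (intro Bochner_Integration.integral_diff sl_int)
    ultimately show ?thesis
      by (simp add: \<Delta>_def emp_mean_diff algebra_simps)
  qed
  have goal_eq: "risk P loss (ghat s) = risk P loss gs + E (ghat s)" for s
    by (simp add: E_def)
  show ?thesis
  \<comment> \<open>Peeling requires a positive rate. For \<open>c = 0\<close> the rate is
    \<open>0 powr q = 0\<close>, so \<open>K = 0\<close> and \<open>a \<le> 0\<close>: the smoothed
    losses vanish and so does the excess risk.\<close>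
  proof (cases "c = 0")
    case True
    have "K = 0" using K K_nonneg True by simp
    then have sl_0: "sl g w = 0" if "g \<in> G" "w \<in> space Pt" for g w
      using K_bound[OF that] by simp
    have "risk P loss (ghat s) \<le> risk P loss gs" if s: "s \<in> space (sample_law n Pt)" for s
    proof -
      have "(\<integral>w. sl (ghat s) w - sl gs w \<partial>Pt) = 0"
        using ghat_in[OF s] gs_in sl_0 by (subst Bochner_Integration.integral_cong[of _ Pt _ "\<lambda>_. 0"]) auto
      moreover have "emp_mean n s (\<lambda>w. sl (ghat s) w - sl gs w) = 0"
      proof -
        have "s i \<in> space Pt" if "i < n" for i
          using s that by (simp add: space_sample_law PiE_iff)
        then have "sl (ghat s) (s i) - sl gs (s i) = 0" if "i < n" for i
          using sl_0[OF ghat_in[OF s]] sl_0[OF gs_in] that by simp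
        then show ?thesis by (simp add: emp_mean_def)
      qed
      ultimately have "(1 - r) * E (ghat s) \<le> 0"
        using basic[OF s] a True by (simp add: \<Delta>_def)
      then show ?thesis using r by (simp add: E_def mult_le_0_iff)
    qed
    then have "outer_expectation (sample_law n Pt) (\<lambda>s. ennreal (risk P loss (ghat s)))
        \<le> (\<integral>\<^sup>+ s. ennreal (risk P loss gs) \<partial>sample_law n Pt)"
      by (intro outer_expectation_le) (auto intro: ennreal_leI)
    then show ?thesis using True by (simp add: S.emeasure_space_1)
  next
    case False
    with c_nonneg have c: "0 < c / sqrt n" "0 < c" using n by auto
    have \<epsilon>: "0 < \<epsilon>" using c n by (simp add: \<epsilon>_def)
    define A where "A = C2 * (\<kappa>0 + 1) powr ((1 - \<rho>) / 2)"
    define y where "y = (2 :: real) powr ((1 - \<rho>) / (2 * \<kappa>))"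
    have A: "0 < A" using C2 \<kappa>0 by (simp add: A_def)
    have y: "1 \<le> y" using \<rho> \<kappa> by (simp add: y_def ge_one_powr_ge_zero)
    have y_sq: "y\<^sup>2 = x" by (simp add: y_def x_def power2_eq_square powr_add[symmetric])
    have "x < 2 powr 1" unfolding x_def using \<kappa> \<rho> by (intro powr_less_mono) auto
    then have x: "0 \<le> x" "x < 2" by (simp_all add: x_def)
    have "0 \<le> ln (real n)" using n by (intro ln_ge_zero) simp
    \<comment> \<open>As \<open>1 + ln n\<close> is at least one, \<open>K / n\<close>, which
      governs the size of one summand, is at most the rate.\<close>
    then have log: "\<epsilon> * n / (1 + ln n) \<le> \<epsilon> * n / 1"
      using \<epsilon> by (intro divide_left_mono) auto
    have "K \<le> \<epsilon> * n / (1 + ln n)"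
      using K powr_rate[OF c(2) \<kappa> \<rho>(1) n] by (simp add: \<epsilon>_def q_def)
    also note log
    finally have K_le: "K / n \<le> \<epsilon>" using n by (simp add: divide_le_eq)
    have "\<exists>W. W \<in> borel_measurable (sample_law n Pt) \<and> (\<forall>s. 0 \<le> W s) \<and>
        (\<integral>\<^sup>+ s. ennreal ((W s)\<^sup>2) \<partial>sample_law n Pt) \<le> ennreal (B * \<epsilon>\<^sup>2 * x ^ j) \<and>
        (\<forall>s\<in>space (sample_law n Pt). \<forall>g\<in>G. E g \<le> 2 ^ j * \<epsilon> \<longrightarrow> \<bar>\<Delta> g s\<bar> \<le> W s)" for j
    proof -
      \<comment> \<open>The Bernstein radius of the shell; \<open>\<kappa>0 + 1\<close> keeps it
        positive when \<open>\<kappa>0 = 0\<close>, since the modulus is controlled at positive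
        radii.\<close>
      define \<delta> where "\<delta> = sqrt (\<kappa>0 + 1) * (2 ^ j * \<epsilon>) powr (1 / (2 * \<kappa>))"
      define GG where "GG = {(g, g'). g \<in> G \<and> g' \<in> G \<and>
        L2_norm \<mu> (\<lambda>w. loss_of loss g w - loss_of loss g' w) \<le> ennreal \<delta>}"
      \<comment> \<open>All pairs within \<open>\<delta>\<close> are taken, so that the supremum
        over \<open>F\<close> is exactly the modulus; the increments \<open>\<Delta>\<close> come
        from the pairs \<open>(g, gs)\<close>.\<close>
      define F where "F = (\<lambda>(g, g') w. sl g w - sl g' w) ` GG"
      have \<delta>: "0 < \<delta>" using \<kappa>0 \<epsilon> by (simp add: \<delta>_def)
      have F_I: "(\<lambda>w. sl g w - sl gs w) \<in> F" if g: "g \<in> G" and Eg: "E g \<le> 2 ^ j * \<epsilon>" for g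
      proof -
        have "(\<integral>w. loss_of loss g w - loss_of loss gs w \<partial>P) = E g"
          unfolding E_def risk_def using g gs_in G
          by (intro Bochner_Integration.integral_diff integrable_loss_of[OF loss]) auto
        then have "(L2_norm \<mu> (\<lambda>w. loss_of loss g w - loss_of loss gs w))\<^sup>2
            \<le> ennreal (\<kappa>0 * E g powr (1 / \<kappa>))"
          using bernstein g by (auto simp: bernstein_class_def)
        also have "\<kappa>0 * E g powr (1 / \<kappa>) \<le> (\<kappa>0 + 1) * (2 ^ j * \<epsilon>) powr (1 / \<kappa>)"
          using \<kappa>0 \<kappa> Eg gs_min[OF g] by (intro mult_mono powr_mono2) auto
        also have "\<dots> = \<delta>\<^sup>2"
        proof -
          have "((2 ^ j * \<epsilon>) powr (1 / (2 * \<kappa>)))\<^sup>2 = (2 ^ j * \<epsilon>) powr (1 / (2 * \<kappa>) + 1 / (2 * \<kappa>))"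
            by (simp only: power2_eq_square powr_add)
          also have "1 / (2 * \<kappa>) + 1 / (2 * \<kappa>) = 1 / \<kappa>"
            using \<kappa> by (simp add: field_simps)
          finally show ?thesis using \<kappa>0 by (simp add: \<delta>_def power_mult_distrib)
        qed
        finally have "L2_norm \<mu> (\<lambda>w. loss_of loss g w - loss_of loss gs w) \<le> ennreal \<delta>"
          using \<delta> by (intro L2_norm_le_of_sq) (auto simp: ennreal_leI)
        then show ?thesis
          unfolding F_def GG_def using g gs_in by (intro image_eqI[of _ _ "(g, gs)"]) auto
      qed
      have "modulus (restrict_space \<nu> X) kl loss Pt n G \<delta> \<mu> = outer_expectation (sample_law n Pt)
          (\<lambda>s. SUP h\<in>F. ennreal \<bar>(\<integral>w. h w \<partial>Pt) - emp_mean n s h\<bar>)"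
        unfolding modulus_def F_def GG_def[symmetric] sl_def image_image Let_def
        by (simp add: case_prod_beta')
      moreover have "c / sqrt n * \<delta> powr (1 - \<rho>) = (\<kappa>0 + 1) powr ((1 - \<rho>) / 2) * \<epsilon> * y ^ j"
        unfolding \<delta>_def y_def
        using c(1) \<kappa> \<rho> \<kappa>0 by (intro modulus_at_shell) (auto simp: \<epsilon>_def q_def)
      then have "C2 * (c / sqrt n) * \<delta> powr (1 - \<rho>) = A * \<epsilon> * y ^ j"
        unfolding A_def by (simp only: mult.assoc)
      ultimately have sup: "outer_expectation (sample_law n Pt)
          (\<lambda>s. SUP h\<in>F. ennreal \<bar>(\<integral>w. h w \<partial>Pt) - emp_mean n s h\<bar>) \<le> ennreal (A * \<epsilon> * y ^ j)"
        using modulus[OF \<delta>] by simp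
      obtain W where W: "W \<in> borel_measurable (sample_law n Pt)" "\<And>s. 0 \<le> W s"
        "\<And>s h. s \<in> space (sample_law n Pt) \<Longrightarrow> h \<in> F \<Longrightarrow>
          \<bar>(\<integral>w. h w \<partial>Pt) - emp_mean n s h\<bar> \<le> W s"
        "(\<integral>\<^sup>+ s. ennreal ((W s)\<^sup>2) \<partial>sample_law n Pt)
          \<le> ennreal (3 * (8 * (A * \<epsilon> * y ^ j) + 2 * (2 * K) / real n)\<^sup>2)"
      \<comment> \<open>Differences are bounded by \<open>2 * K\<close> and centring doubles this,
        whence the 4 in \<open>B\<close>.\<close>
      proof (rule Pt.empirical_process_second_moment[OF _ _ sup _ _ n, of "2 * K"])
        fix h assume "h \<in> F"
        then obtain g g' where h: "h = (\<lambda>w. sl g w - sl g' w)" "g \<in> G" "g' \<in> G"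
          by (auto simp: F_def GG_def)
        show "h \<in> borel_measurable Pt"
          unfolding h(1) using sl_meas h by (intro borel_measurable_diff) auto
        show "\<bar>h w\<bar> \<le> 2 * K" if "w \<in> space Pt" for w
          using K_bound[OF h(2) that] K_bound[OF h(3) that] by (simp add: h(1))
      qed (use A \<epsilon> y K_nonneg in auto)
      \<comment> \<open>Since \<open>y \<ge> 1\<close>, the summand size is at most a multiple of
        \<open>\<epsilon> * y ^ j\<close>, the scale of the modulus.\<close>
      have "\<epsilon> * 1 \<le> \<epsilon> * y ^ j"
        using \<epsilon> one_le_power[OF y] by (intro mult_left_mono) auto
      then have "8 * (A * \<epsilon> * y ^ j) + 2 * (2 * K) / real n \<le> 8 * (A * \<epsilon> * y ^ j) + 4 * (\<epsilon> * y ^ j)"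
        using K_le by (simp add: mult.assoc flip: times_divide_eq_right)
      also have "\<dots> = (8 * A + 4) * \<epsilon> * y ^ j" by (simp add: algebra_simps)
      finally have "3 * (8 * (A * \<epsilon> * y ^ j) + 2 * (2 * K) / real n)\<^sup>2
          \<le> 3 * ((8 * A + 4) * \<epsilon> * y ^ j)\<^sup>2"
        using A \<epsilon> y K_nonneg by (intro mult_left_mono power_mono) auto
      also have "\<dots> = B * \<epsilon>\<^sup>2 * x ^ j"
        by (simp add: B_def A_def y_sq[symmetric] power_mult_distrib power_mult[symmetric] mult.commute[of j])
      finally have "(\<integral>\<^sup>+ s. ennreal ((W s)\<^sup>2) \<partial>sample_law n Pt) \<le> ennreal (B * \<epsilon>\<^sup>2 * x ^ j)"
        using W(4) by (meson ennreal_leI order_trans)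
      moreover have "\<bar>\<Delta> g s\<bar> \<le> W s" if "s \<in> space (sample_law n Pt)" "g \<in> G" "E g \<le> 2 ^ j * \<epsilon>" for g s
        unfolding \<Delta>_def using that by (intro W(3) F_I)
      ultimately show ?thesis using W(1,2) by blast
    qed
    then obtain W where W: "\<And>j. W j \<in> borel_measurable (sample_law n Pt)" "\<And>j s. 0 \<le> W j s"
      "\<And>j. (\<integral>\<^sup>+ s. ennreal ((W j s)\<^sup>2) \<partial>sample_law n Pt) \<le> ennreal (B * \<epsilon>\<^sup>2 * x ^ j)"
      "\<And>j s g. s \<in> space (sample_law n Pt) \<Longrightarrow> g \<in> G \<Longrightarrow> E g \<le> 2 ^ j * \<epsilon> \<Longrightarrow> \<bar>\<Delta> g s\<bar> \<le> W j s"
      by metis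
    show ?thesis
      unfolding goal_eq \<epsilon>_def[symmetric]
    \<comment> \<open>Here \<open>\<theta>\<close> is \<open>1 - r\<close>, the constant
      \<open>c\<close> of the peeling lemma is \<open>C1\<close>, and the offset is the minimal
      risk.\<close>
    proof (rule outer_expectation_peeling[where W = W])
      show "(1 - r) * E (ghat s) \<le> C1 * \<epsilon> + W j s"
        if "s \<in> space (sample_law n Pt)" "E (ghat s) \<le> 2 ^ j * \<epsilon>" for j s
        using basic[OF that(1)] W(4)[OF that(1) ghat_in[OF that(1)] that(2)] a
        by (simp add: \<epsilon>_def)
    qed (use C1 r \<epsilon> x R0 W in \<open>auto simp: B_def S.prob_space_axioms\<close>)
  qed
qed

section \<open>One constant for all models\<close>

theorem theorem1:
  fixes C1 C2 \<kappa> \<kappa>0 \<rho> r :: real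
  assumes "0 < C1" and "0 < C2" and "1 < \<kappa>" and "0 \<le> \<kappa>0"
    and "0 < \<rho>" and "\<rho> < 1" and "0 < r" and "r < 1"
  shows "\<exists>C>0.
    \<forall>d M X Xt \<nu> P Pt f fy A loss G
      (k :: (nat \<Rightarrow> real) \<Rightarrow> (nat \<Rightarrow> real) \<Rightarrow> (nat \<Rightarrow> real) \<Rightarrow> real)
      (lam :: nat \<Rightarrow> nat \<Rightarrow> real) \<mu> c K a gs ghat.
      inverse_learning d M X Xt \<nu> P Pt f fy A \<and>
      loss_function M loss \<and>
      G \<subseteq> borel_measurable (restrict_space (Rd d) X) \<and>
      sets \<mu> = sets (restrict_space (Rd d) X \<Otimes>\<^sub>M count_space {0..M}) \<and>
      is_arg_min (risk P loss) (\<lambda>g. g \<in> G) gs \<and>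
      (\<forall>g. is_arg_min (risk P loss) (\<lambda>g. g \<in> G) g \<longrightarrow> (\<forall>x\<in>X. g x = gs x)) \<and>
      bernstein_class P \<mu> \<kappa> \<kappa>0 ((\<lambda>g w. loss_of loss g w - loss_of loss gs w) ` G) \<and>
      (\<forall>n\<ge>1.
        lam n \<in> {..<d} \<rightarrow>\<^sub>E {0..} \<and>
        admissible_kernel (restrict_space \<nu> X) (restrict_space \<nu> Xt) M loss G (k (lam n)) \<and>
        LB_class (restrict_space \<nu> X) (k (lam n)) loss Pt \<mu> G (c (lam n)) (K (lam n)) \<and>
        approximation_function (restrict_space \<nu> X) (k (lam n)) loss P Pt n G gs (a (lam n)) r \<and>
        a (lam n) \<le> C1 * (c (lam n) / sqrt n) powr (2 * \<kappa> / (2 * \<kappa> + \<rho> - 1)) \<and>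
        K (lam n) \<le> c (lam n) powr (2 * \<kappa> / (2 * \<kappa> + \<rho> - 1))
                      * real n powr ((\<kappa> + \<rho> - 1) / (2 * \<kappa> + \<rho> - 1)) / (1 + ln n) \<and>
        (\<forall>\<delta>>0. modulus (restrict_space \<nu> X) (k (lam n)) loss Pt n G \<delta> \<mu>
                  \<le> ennreal (C2 * (c (lam n) / sqrt n) * \<delta> powr (1 - \<rho>))) \<and>
        (\<forall>s\<in>space (sample_law n Pt).
           is_arg_min (emp_smooth_risk (restrict_space \<nu> X) (k (lam n)) loss n s)
             (\<lambda>g. g \<in> G) (ghat n s)))
      \<longrightarrow>
      (\<forall>\<^sub>F n in sequentially.
        outer_expectation (sample_law n Pt) (\<lambda>s. ennreal (risk P loss (ghat n s)))
          \<le> ennreal (risk P loss gs + C * (c (lam n) / sqrt n) powr (2 * \<kappa> / (2 * \<kappa> + \<rho> - 1))))"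
proof -
  \<comment> \<open>The constant is fixed before any model is introduced, hence uniform in the
    dimension, the laws and the kernel.\<close>
  define C where "C = 1 + 2 * C1 / (1 - r)
    + 8 * (3 * (8 * (C2 * (\<kappa>0 + 1) powr ((1 - \<rho>) / 2)) + 4)\<^sup>2) / (1 - r)\<^sup>2
      / (1 - 2 powr ((1 - \<rho>) / \<kappa>) / 2)"
  \<comment> \<open>From \<open>1 - \<rho> < 1 < \<kappa>\<close>; it makes the denominator from the
    geometric series positive.\<close>
  have "2 powr ((1 - \<rho>) / \<kappa>) < 2 powr (1 :: real)"
    using assms by (intro powr_less_mono) auto
  then have "0 < C"
    unfolding C_def using assms by (intro add_pos_nonneg) auto
  show ?thesis
    \<comment> \<open>The bound holds from \<open>n = 1\<close> on, so one threshold serves every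
      model.\<close>
    by (intro exI[of _ C] conjI \<open>0 < C\<close> allI impI eventually_sequentiallyI[of 1], unfold C_def,
        elim conjE, rule inverse_learning.excess_risk_bound[OF _ assms]) (assumption | blast)+
qed

end
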